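(* Let $n\in\mathbb N$. (a) All of $\mathcal B_r$, $\mathcal B_c$, $\mathcal A_r^n$ and $\mathcal A_c^n$ are abstract $M$ spaces. (b) None of $\mathcal B_r$, $\mathcal B_c$, $\mathcal A_r^n$ or $\mathcal A_c^n$ are abstract $L$ spaces.
   Context: Write $\overline{\mathbb R}=[-\infty,\infty]$. A function $F:\overline{\mathbb R}\to\mathbb R$ is regulated if the one-sided limits $F(x-),F(x+)$ exist in $\mathbb R$ for every $x\in\mathbb R$ and the limits $\lim_{x\to\pm\infty}F(x)$ exist in $\mathbb R$; by convention $F(\pm\infty)$ equals these limits. $\mathcal B_r$ is the space of regulated $F$ with $F(-\infty)=0$ and $F(x)=F(x-)$ for all $x\in\mathbb R$; $\mathcal B_c$ is the space of continuous $F:\overline{\mathbb R}\to\mathbb R$ with $F(-\infty)=0$; norm $\|F\|_\infty=\sup_{x\in\mathbb R}|F(x)|$; order: $F_1\le F_2$ iff $F_1(x)\le F_2(x)$ for all $x\in\mathbb R$. $\mathcal A_r^n$ (resp. $\mathcal A_c^n$) is the set of distributions $f$ on $\mathbb R$ with $f=F^{(n)}$ (distributional derivative) for some $F\in\mathcal B_r$ (resp. $\mathcal B_c$); $F$ is unique (the primitive of $f$), $\|f\|_{a,n}=\|F\|_\infty$, and $f_1\preceq f_2$ iff the primitives satisfy $F_1\le F_2$. With these norms and orders all four are Banach lattices. A Banach lattice is an abstract $L$ space if $\|x+y\|=\|x\|+\|y\|$ for all $x,y\ge0$, and an abstract $M$ space if $\|x\vee y\|=\max(\|x\|,\|y\|)$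 for all $x,y\ge0$. *)

theory Defs
  imports "HOL-Analysis.Analysis" "HOL-Algebra.Lattice" "HOL-Library.Function_Algebras"
begin

section \<open>Pointwise real vector spaces of functions\<close>

instantiation "fun" :: (type, real_vector) real_vector
begin

definition scaleR_fun_def: "c *\<^sub>R f = (\<lambda>x. c *\<^sub>R f x)"

instance
  by standard (simp_all add: scaleR_fun_def fun_eq_iff scaleR_add_right scaleR_add_left)

end


section \<open>Banach lattices, abstract L spaces and abstract M spaces\<close>

text \<open>The linear operations are those of the ambient type, of which the carrier is a subspace.
  In the locale, \<open>x \<squnion> - x\<close> is the absolute value of \<open>x\<close>.\<close>

record 'a normed_gorder = "'a gorder" +
  nrm :: "'a \<Rightarrow> real"

locale banach_lattice = lattice L
  for L :: "('a::real_vector, 'm) normed_gorder_scheme" (structure) +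
  assumes carrier_subspace: "subspace (carrier L)"
    and add_right_mono:
      "\<lbrakk>x \<in> carrier L; y \<in> carrier L; z \<in> carrier L; x \<sqsubseteq> y\<rbrakk> \<Longrightarrow> x + z \<sqsubseteq> y + z"
    and scaleR_left_mono:
      "\<lbrakk>x \<in> carrier L; y \<in> carrier L; 0 \<le> c; x \<sqsubseteq> y\<rbrakk> \<Longrightarrow> c *\<^sub>R x \<sqsubseteq> c *\<^sub>R y"
    and nrm_nonneg: "x \<in> carrier L \<Longrightarrow> 0 \<le> nrm L x"
    and nrm_eq_zero: "x \<in> carrier L \<Longrightarrow> nrm L x = 0 \<longleftrightarrow> x = 0"
    and nrm_scaleR: "x \<in> carrier L \<Longrightarrow> nrm L (c *\<^sub>R x) = \<bar>c\<bar> * nrm L x"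
    and nrm_triangle:
      "\<lbrakk>x \<in> carrier L; y \<in> carrier L\<rbrakk> \<Longrightarrow> nrm L (x + y) \<le> nrm L x + nrm L y"
    and nrm_lattice:
      "\<lbrakk>x \<in> carrier L; y \<in> carrier L; x \<squnion> - x \<sqsubseteq> y \<squnion> - y\<rbrakk> \<Longrightarrow> nrm L x \<le> nrm L y"
    and nrm_complete:
      "\<lbrakk>range X \<subseteq> carrier L; \<forall>e>0. \<exists>N. \<forall>i\<ge>N. \<forall>j\<ge>N. nrm L (X i - X j) < e\<rbrakk>
        \<Longrightarrow> \<exists>x\<in>carrier L. (\<lambda>i. nrm L (X i - x)) \<longlonglongrightarrow> 0"

locale abstract_L_space = banach_lattice +
  assumes nrm_add:
    "\<lbrakk>x \<in> carrier L; y \<in> carrier L; 0 \<sqsubseteq> x; 0 \<sqsubseteq> y\<rbrakk> \<Longrightarrow> nrm L (x + y) = nrm L x + nrm L y"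

locale abstract_M_space = banach_lattice +
  assumes nrm_join:
    "\<lbrakk>x \<in> carrier L; y \<in> carrier L; 0 \<sqsubseteq> x; 0 \<sqsubseteq> y\<rbrakk>
      \<Longrightarrow> nrm L (x \<squnion> y) = max (nrm L x) (nrm L y)"


section \<open>Regulated and continuous functions on the extended real line\<close>

definition regulated :: "(ereal \<Rightarrow> real) \<Rightarrow> bool" where
  "regulated F \<longleftrightarrow>
    (\<forall>x::real. (\<exists>l. ((\<lambda>t. F (ereal t)) \<longlongrightarrow> l) (at_left x)) \<and>
              (\<exists>l. ((\<lambda>t. F (ereal t)) \<longlongrightarrow> l) (at_right x))) \<and>
    ((\<lambda>t. F (ereal t)) \<longlongrightarrow> F (-\<infinity>)) at_bot \<and>
    ((\<lambda>t. F (ereal t)) \<longlongrightarrow> F \<infinity>) at_top"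

definition regulated_primitives :: "(ereal \<Rightarrow> real) set" where
  "regulated_primitives = {F. regulated F \<and> F (-\<infinity>) = 0 \<and>
    (\<forall>x::real. ((\<lambda>t. F (ereal t)) \<longlongrightarrow> F (ereal x)) (at_left x))}"

definition continuous_primitives :: "(ereal \<Rightarrow> real) set" where
  "continuous_primitives = {F. continuous_on UNIV F \<and> F (-\<infinity>) = 0}"

definition sup_norm_space :: "(ereal \<Rightarrow> real) set \<Rightarrow> (ereal \<Rightarrow> real) normed_gorder" where
  "sup_norm_space C = \<lparr>carrier = C, eq = (=),
    le = (\<lambda>F G. \<forall>x::real. F (ereal x) \<le> G (ereal x)),
    nrm = (\<lambda>F. SUP x::real. \<bar>F (ereal x)\<bar>)\<rparr>"

definition B_r :: "(ereal \<Rightarrow> real) normed_gorder" where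
  "B_r = sup_norm_space regulated_primitives"

definition B_c :: "(ereal \<Rightarrow> real) normed_gorder" where
  "B_c = sup_norm_space continuous_primitives"


section \<open>Test functions and distributions on the real line\<close>

definition is_test_fun :: "(real \<Rightarrow> real) \<Rightarrow> bool" where
  "is_test_fun \<phi> \<longleftrightarrow>
    (\<forall>k. (deriv ^^ k) \<phi> differentiable_on UNIV) \<and> compact (closure {x. \<phi> x \<noteq> 0})"

lemma higher_deriv_zero: "(deriv ^^ k) (\<lambda>x::real. 0::real) = (\<lambda>x. 0)"
  by (induction k) auto

lemma higher_deriv_add:
  fixes \<phi> \<psi> :: "real \<Rightarrow> real"
  assumes "\<And>k. (deriv ^^ k) \<phi> differentiable_on UNIV" "\<And>k. (deriv ^^ k) \<psi> differentiable_on UNIV"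
  shows "(deriv ^^ k) (\<lambda>x. \<phi> x + \<psi> x) = (\<lambda>x. (deriv ^^ k) \<phi> x + (deriv ^^ k) \<psi> x)"
proof (induction k)
  case (Suc k)
  have "(deriv ^^ k) \<phi> field_differentiable at x" "(deriv ^^ k) \<psi> field_differentiable at x" for x
    using assms[of k] by (auto simp: differentiable_on_def field_differentiable_def
        real_differentiable_def)
  then show ?case
    by (simp add: Suc.IH fun_eq_iff)
qed simp

lemma higher_deriv_cmult:
  fixes \<phi> :: "real \<Rightarrow> real"
  assumes "\<And>k. (deriv ^^ k) \<phi> differentiable_on UNIV"
  shows "(deriv ^^ k) (\<lambda>x. c * \<phi> x) = (\<lambda>x. c * (deriv ^^ k) \<phi> x)"
proof (induction k)
  case (Suc k)
  have "(deriv ^^ k) \<phi> field_differentiable at x" for x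
    using assms[of k] by (auto simp: differentiable_on_def field_differentiable_def
        real_differentiable_def)
  then show ?case
    by (simp add: Suc.IH fun_eq_iff)
qed simp

lemma compact_closure_subset:
  fixes A B :: "real set"
  shows "compact (closure B) \<Longrightarrow> A \<subseteq> B \<Longrightarrow> compact (closure A)"
  by (meson bounded_subset compact_closure)

lemma is_test_fun_zero: "is_test_fun (\<lambda>x. 0)"
  by (simp add: is_test_fun_def higher_deriv_zero)

lemma is_test_fun_add: "is_test_fun (\<lambda>x. \<phi> x + \<psi> x)" if "is_test_fun \<phi>" "is_test_fun \<psi>"
proof -
  have "compact (closure ({x. \<phi> x \<noteq> 0} \<union> {x. \<psi> x \<noteq> 0}))"
    using that by (simp add: is_test_fun_def compact_Un)
  then have "compact (closure {x. \<phi> x + \<psi> x \<noteq> 0})"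
    by (rule compact_closure_subset) auto
  then show ?thesis
    using that by (simp add: is_test_fun_def higher_deriv_add)
qed

lemma is_test_fun_cmult: "is_test_fun (\<lambda>x. c * \<phi> x)" if "is_test_fun \<phi>"
proof -
  have "compact (closure {x. c * \<phi> x \<noteq> 0})"
    using that compact_closure_subset[of "{x. \<phi> x \<noteq> 0}" "{x. c * \<phi> x \<noteq> 0}"]
    unfolding is_test_fun_def by fastforce
  then show ?thesis
    using that by (simp add: is_test_fun_def higher_deriv_cmult)
qed

lemma is_test_fun_deriv: "is_test_fun (deriv \<phi>)" if "is_test_fun \<phi>"
proof -
  have "deriv \<phi> x = 0" if x: "x \<notin> closure {x. \<phi> x \<noteq> 0}" for x
  proof -
    have "\<forall>\<^sub>F y in nhds x. y \<in> - closure {x. \<phi> x \<noteq> 0}"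
      using x by (intro eventually_nhds_in_open) auto
    then have "\<forall>\<^sub>F y in nhds x. \<phi> y = 0"
      by eventually_elim (use closure_subset[of "{x. \<phi> x \<noteq> 0}"] in auto)
    then have "deriv \<phi> x = deriv (\<lambda>_. 0) x"
      by (intro deriv_cong_ev refl)
    then show ?thesis
      by simp
  qed
  then have "{x. deriv \<phi> x \<noteq> 0} \<subseteq> closure {x. \<phi> x \<noteq> 0}"
    by auto
  then have "compact (closure {x. deriv \<phi> x \<noteq> 0})"
    using that compact_closure_subset[of "closure {x. \<phi> x \<noteq> 0}"] by (simp add: is_test_fun_def)
  moreover have "(deriv ^^ k) (deriv \<phi>) differentiable_on UNIV" for k
    using that unfolding is_test_fun_def by (metis comp_apply funpow_Suc_right)
  ultimately show ?thesis
    by (simp add: is_test_fun_def)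
qed

typedef test_fun = "{\<phi>. is_test_fun \<phi>}"
  morphisms test_app Abs_test_fun
  using is_test_fun_zero by auto

setup_lifting type_definition_test_fun

instantiation test_fun :: real_vector
begin

lift_definition zero_test_fun :: test_fun is "\<lambda>x. 0"
  by (rule is_test_fun_zero)

lift_definition plus_test_fun :: "test_fun \<Rightarrow> test_fun \<Rightarrow> test_fun" is "\<lambda>\<phi> \<psi> x. \<phi> x + \<psi> x"
  by (rule is_test_fun_add)

lift_definition scaleR_test_fun :: "real \<Rightarrow> test_fun \<Rightarrow> test_fun" is "\<lambda>c \<phi> x. c * \<phi> x"
  by (rule is_test_fun_cmult)

definition uminus_test_fun :: "test_fun \<Rightarrow> test_fun" where
  "uminus_test_fun \<phi> = (-1) *\<^sub>R \<phi>"

definition minus_test_fun :: "test_fun \<Rightarrow> test_fun \<Rightarrow> test_fun" where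
  "minus_test_fun \<phi> \<psi> = \<phi> + (- \<psi>)"

instance
  by standard
    (unfold minus_test_fun_def uminus_test_fun_def,
      (transfer, simp add: algebra_simps fun_eq_iff)+)

end

lift_definition test_deriv :: "test_fun \<Rightarrow> test_fun" is deriv
  by (rule is_test_fun_deriv)

definition test_converges :: "(nat \<Rightarrow> test_fun) \<Rightarrow> test_fun \<Rightarrow> bool" where
  "test_converges \<Phi> \<phi> \<longleftrightarrow>
    (\<exists>K. compact K \<and> (\<forall>j. {x. test_app (\<Phi> j) x \<noteq> 0} \<subseteq> K)) \<and>
    (\<forall>k. uniform_limit UNIV (\<lambda>j. (deriv ^^ k) (test_app (\<Phi> j)))
           ((deriv ^^ k) (test_app \<phi>)) sequentially)"

text \<open>For linear functionals on test functions, continuity in the usual inductive limit topology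
  is the same as sequential continuity.\<close>

definition is_distribution :: "(test_fun \<Rightarrow> real) \<Rightarrow> bool" where
  "is_distribution f \<longleftrightarrow> linear f \<and>
    (\<forall>\<Phi> \<phi>. test_converges \<Phi> \<phi> \<longrightarrow> (\<lambda>j. f (\<Phi> j)) \<longlonglongrightarrow> f \<phi>)"

definition dist_deriv :: "(test_fun \<Rightarrow> real) \<Rightarrow> test_fun \<Rightarrow> real" where
  "dist_deriv f = (\<lambda>\<phi>. - f (test_deriv \<phi>))"

definition dist_of_fun :: "(ereal \<Rightarrow> real) \<Rightarrow> test_fun \<Rightarrow> real" where
  "dist_of_fun F = (\<lambda>\<phi>. LINT x|lborel. F (ereal x) * test_app \<phi> x)"


section \<open>Spaces of n-th distributional derivatives\<close>

definition dist_primitive :: "(ereal \<Rightarrow> real) set \<Rightarrow> nat \<Rightarrow> (test_fun \<Rightarrow> real) \<Rightarrow> ereal \<Rightarrow> real" where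
  "dist_primitive C n f = (THE F. F \<in> C \<and> f = (dist_deriv ^^ n) (dist_of_fun F))"

definition deriv_space ::
    "(ereal \<Rightarrow> real) normed_gorder \<Rightarrow> nat \<Rightarrow> (test_fun \<Rightarrow> real) normed_gorder" where
  "deriv_space B n = \<lparr>
    carrier = {f. is_distribution f \<and>
      (\<exists>F \<in> carrier B. f = (dist_deriv ^^ n) (dist_of_fun F))},
    eq = (=),
    le = (\<lambda>f g. dist_primitive (carrier B) n f \<sqsubseteq>\<^bsub>B\<^esub> dist_primitive (carrier B) n g),
    nrm = (\<lambda>f. nrm B (dist_primitive (carrier B) n f))\<rparr>"

definition A_r :: "nat \<Rightarrow> (test_fun \<Rightarrow> real) normed_gorder" where
  "A_r n = deriv_space B_r n"

definition A_c :: "nat \<Rightarrow> (test_fun \<Rightarrow> real) normed_gorder" where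
  "A_c n = deriv_space B_c n"

end

theory Submission
  imports Defs
begin

text \<open>Both function spaces are closed under pointwise maxima and uniform limits, and pointwise
  maxima are their joins, which gives the abstract M space property. The map sending \<open>F\<close> to the
  \<open>n\<close>-th distributional derivative of \<open>F\<close> is linear and, by construction, an isometric lattice
  isomorphism as soon as it is injective. For injectivity, a difference of translates
  \<open>\<psi>(x + h) - \<psi>(x)\<close> is the derivative of a test function, so a distribution with zero derivative
  is translation invariant; since the pairing of \<open>F\<close> (and of its derivatives) with translated test
  functions tends to \<open>0\<close> as the translates move towards \<open>-\<infinity>\<close>, the distribution vanishes, and by
  testing against bump functions so does the left-continuous \<open>F\<close>. Additivity of the norm fails for
  a tent and a ramp whose sum is another ramp.\<close>

lemma scaleR_fun_apply [simp]: "(c *\<^sub>R f) x = c *\<^sub>R f x"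
  by (simp add: scaleR_fun_def)

section \<open>Transport of the Banach lattice structure\<close>

lemma (in weak_partial_order) least_Upper_pair_iff:
  assumes "x \<in> carrier L" "y \<in> carrier L"
  shows "least L s (Upper L {x, y}) \<longleftrightarrow> s \<in> carrier L \<and> x \<sqsubseteq> s \<and> y \<sqsubseteq> s \<and>
    (\<forall>u\<in>carrier L. x \<sqsubseteq> u \<and> y \<sqsubseteq> u \<longrightarrow> s \<sqsubseteq> u)"
  using assms by (auto simp: least_def Upper_def)

lemma (in weak_partial_order) greatest_Lower_pair_iff:
  assumes "x \<in> carrier L" "y \<in> carrier L"
  shows "greatest L s (Lower L {x, y}) \<longleftrightarrow> s \<in> carrier L \<and> s \<sqsubseteq> x \<and> s \<sqsubseteq> y \<and>
    (\<forall>u\<in>carrier L. u \<sqsubseteq> x \<and> u \<sqsubseteq> y \<longrightarrow> u \<sqsubseteq> s)"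
  using assms by (auto simp: greatest_def Lower_def)

text \<open>\<open>join\<close> merely chooses some least upper bound; antisymmetry makes it unique,
  so a join can be computed by exhibiting any candidate.\<close>

lemma (in partial_order) join_eqI:
  assumes "x \<in> carrier L" "y \<in> carrier L" "s \<in> carrier L" "x \<sqsubseteq> s" "y \<sqsubseteq> s"
    and "\<And>u. u \<in> carrier L \<Longrightarrow> x \<sqsubseteq> u \<Longrightarrow> y \<sqsubseteq> u \<Longrightarrow> s \<sqsubseteq> u"
  shows "x \<squnion> y = s"
proof -
  have "least L s (Upper L {x, y})"
    using assms by (simp add: least_Upper_pair_iff)
  then show ?thesis
    unfolding join_def sup_def using least_unique by (blast intro: some_equality)
qed

text \<open>Order and norm are read off through an explicit inverse \<open>J\<close> instead of
  being pushed along \<open>T\<close>. This matches the shape of \<open>deriv_space\<close>, with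
  \<open>dist_primitive\<close> in the role of \<open>J\<close>.\<close>

definition transported_space ::
    "('a, 'm) normed_gorder_scheme \<Rightarrow> ('a \<Rightarrow> 'b) \<Rightarrow> ('b \<Rightarrow> 'a) \<Rightarrow> 'b normed_gorder" where
  "transported_space B T J = \<lparr>carrier = T ` carrier B, eq = (=),
    le = (\<lambda>f g. J f \<sqsubseteq>\<^bsub>B\<^esub> J g), nrm = (\<lambda>f. nrm B (J f))\<rparr>"

text \<open>\<open>J_T\<close> makes \<open>T\<close> injective on the carrier of \<open>B\<close>.
  By the definition of the transported order and norm, \<open>T\<close> is then automatically an
  isometric order isomorphism onto its image.\<close>

locale isometric_transport = B: banach_lattice B
  for B :: "('a::real_vector, 'm) normed_gorder_scheme" (structure) +
  fixes T :: "'a \<Rightarrow> 'b::real_vector" and J :: "'b \<Rightarrow> 'a"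
  assumes T_add: "x \<in> carrier B \<Longrightarrow> y \<in> carrier B \<Longrightarrow> T (x + y) = T x + T y"
    and T_scaleR: "x \<in> carrier B \<Longrightarrow> T (c *\<^sub>R x) = c *\<^sub>R T x"
    and J_T [simp]: "x \<in> carrier B \<Longrightarrow> J (T x) = x"
begin

abbreviation L where "L \<equiv> transported_space B T J"

lemma transported_sel [simp]:
  "carrier L = T ` carrier B" "(f .=\<^bsub>L\<^esub> g) = (f = g)"
  "(f \<sqsubseteq>\<^bsub>L\<^esub> g) = (J f \<sqsubseteq> J g)" "nrm L f = nrm B (J f)"
  by (simp_all add: transported_space_def)

lemma carrier_closed [simp]:
  "0 \<in> carrier B"
  "x \<in> carrier B \<Longrightarrow> y \<in> carrier B \<Longrightarrow> x + y \<in> carrier B"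
  "x \<in> carrier B \<Longrightarrow> c *\<^sub>R x \<in> carrier B"
  "x \<in> carrier B \<Longrightarrow> - x \<in> carrier B"
  "x \<in> carrier B \<Longrightarrow> y \<in> carrier B \<Longrightarrow> x - y \<in> carrier B"
  using B.carrier_subspace
  by (auto simp: subspace_0 subspace_add subspace_scale subspace_diff subspace_neg)

lemma T_uminus: "x \<in> carrier B \<Longrightarrow> T (- x) = - T x"
  using T_scaleR[of x "-1"] by simp

lemma T_diff: "x \<in> carrier B \<Longrightarrow> y \<in> carrier B \<Longrightarrow> T (x - y) = T x - T y"
  using T_add[of x "- y"] by (simp add: T_uminus)

lemma T_zero: "T 0 = 0"
  using T_scaleR[of 0 0] by simp

lemma J_lin [simp]:
  "J 0 = 0"
  "x \<in> carrier B \<Longrightarrow> y \<in> carrier B \<Longrightarrow> J (T x + T y) = x + y"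
  "x \<in> carrier B \<Longrightarrow> y \<in> carrier B \<Longrightarrow> J (T x - T y) = x - y"
  "x \<in> carrier B \<Longrightarrow> J (c *\<^sub>R T x) = c *\<^sub>R x"
  "x \<in> carrier B \<Longrightarrow> J (- T x) = - x"
  using J_T[of 0] J_T[of "x + y"] J_T[of "x - y"] J_T[of "c *\<^sub>R x"] J_T[of "- x"]
  by (simp_all add: T_zero T_add T_diff T_scaleR T_uminus)

lemma partial_order_transported: "partial_order L"
proof
qed (auto intro: B.le_trans dest: B.le_antisym simp: fun_eq_iff)

sublocale L: partial_order L
  by (rule partial_order_transported)

text \<open>Both the lattice norm axiom and the abstract M space axiom speak about joins, so these
  have to be carried over before the norm axioms can be.\<close>

lemma join_transported:
  assumes "x \<in> carrier B" "y \<in> carrier B"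
  shows "T x \<squnion>\<^bsub>L\<^esub> T y = T (x \<squnion> y)"
  using assms by (intro L.join_eqI) (auto intro: B.join_left B.join_right B.join_le)

lemma lattice_transported: "lattice L"
proof
  fix f g assume "f \<in> carrier L" "g \<in> carrier L"
  then obtain x y where xy: "x \<in> carrier B" "y \<in> carrier B" "f = T x" "g = T y"
    by auto
  then have "least L (T (x \<squnion> y)) (Upper L {f, g})"
    by (auto simp: L.least_Upper_pair_iff intro: B.join_left B.join_right B.join_le)
  then show "\<exists>s. least L s (Upper L {f, g})" ..
  have "greatest L (T (x \<sqinter> y)) (Lower L {f, g})"
    using xy by (auto simp: L.greatest_Lower_pair_iff intro: B.meet_left B.meet_right B.meet_le)
  then show "\<exists>s. greatest L s (Lower L {f, g})" ..
qed

lemma banach_lattice_transported: "banach_lattice L"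
proof -
  interpret L: lattice L
    by (rule lattice_transported)
  show ?thesis
  proof
    show "subspace (carrier L)"
      by (auto simp: subspace_def T_zero[symmetric] T_add[symmetric] T_scaleR[symmetric])
    fix f assume "f \<in> carrier L"
    then obtain x where x: "x \<in> carrier B" "f = T x"
      by auto
    show "0 \<le> nrm L f" "nrm L f = 0 \<longleftrightarrow> f = 0" "nrm L (c *\<^sub>R f) = \<bar>c\<bar> * nrm L f" for c
      using x B.nrm_nonneg B.nrm_eq_zero B.nrm_scaleR J_lin(1) T_zero by (auto; metis J_T)+
    fix g assume "g \<in> carrier L"
    then obtain y where y: "y \<in> carrier B" "g = T y"
      by auto
    show "nrm L (f + g) \<le> nrm L f + nrm L g"
      using x y by (simp add: B.nrm_triangle)
    show "c *\<^sub>R f \<sqsubseteq>\<^bsub>L\<^esub> c *\<^sub>R g" if "0 \<le> c" "f \<sqsubseteq>\<^bsub>L\<^esub> g" for c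
      using x y that by (simp add: B.scaleR_left_mono)
    show "f + h \<sqsubseteq>\<^bsub>L\<^esub> g + h" if "h \<in> carrier L" "f \<sqsubseteq>\<^bsub>L\<^esub> g" for h
      using x y that by (auto simp: B.add_right_mono)
    show "nrm L f \<le> nrm L g" if "f \<squnion>\<^bsub>L\<^esub> - f \<sqsubseteq>\<^bsub>L\<^esub> g \<squnion>\<^bsub>L\<^esub> - g"
      using that x y
      by (simp add: T_uminus[symmetric] join_transported B.nrm_lattice)
  next
    fix X :: "nat \<Rightarrow> 'b"
    assume X: "range X \<subseteq> carrier L" and
      Cauchy: "\<forall>e>0. \<exists>N. \<forall>i\<ge>N. \<forall>j\<ge>N. nrm L (X i - X j) < e"
    \<comment> \<open>Completeness: the Cauchy sequence is pulled back by \<open>J\<close>, its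
      limit \<open>x\<close> is found in \<open>B\<close>, and \<open>T x\<close> is the limit in
      the transported space.\<close>
    have JX: "J (X i) \<in> carrier B" "T (J (X i)) = X i" for i
    proof -
      have "X i \<in> T ` carrier B"
        using X by auto
      then show "J (X i) \<in> carrier B" "T (J (X i)) = X i"
        by auto
    qed
    have J_diff: "J (X i - T x) = J (X i) - x" if "x \<in> carrier B" for i x
      using J_lin(3)[OF JX(1) that] JX(2) by simp
    have "\<exists>x\<in>carrier B. (\<lambda>i. nrm B (J (X i) - x)) \<longlonglongrightarrow> 0"
    proof (rule B.nrm_complete)
      have "J (X i - X j) = J (X i) - J (X j)" for i j
        using J_diff[OF JX(1)] JX(2) by metis
      then show "\<forall>e>0. \<exists>N. \<forall>i\<ge>N. \<forall>j\<ge>N. nrm B (J (X i) - J (X j)) < e"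
        using Cauchy by simp
    qed (use JX in auto)
    then obtain x where "x \<in> carrier B" "(\<lambda>i. nrm B (J (X i) - x)) \<longlonglongrightarrow> 0" ..
    then show "\<exists>f\<in>carrier L. (\<lambda>i. nrm L (X i - f)) \<longlonglongrightarrow> 0"
      by (auto simp: J_diff)
  qed
qed

lemma abstract_M_space_transported:
  assumes "abstract_M_space B"
  shows "abstract_M_space L"
proof -
  interpret L: banach_lattice L
    by (rule banach_lattice_transported)
  interpret M: abstract_M_space B
    by fact
  show ?thesis
    by standard (auto simp: join_transported M.nrm_join)
qed

text \<open>Used contrapositively: once additivity of the norm fails in \<open>B\<close>, it fails
  in every transported copy.\<close>

lemma abstract_L_space_transportedD:
  assumes "abstract_L_space L"
  shows "abstract_L_space B"
proof -
  interpret L: abstract_L_space L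
    by fact
  show ?thesis
  proof
    fix x y assume "x \<in> carrier B" "y \<in> carrier B" "0 \<sqsubseteq> x" "0 \<sqsubseteq> y"
    then show "nrm B (x + y) = nrm B x + nrm B y"
      using L.nrm_add[of "T x" "T y"] by simp
  qed
qed

end

section \<open>Regulated functions\<close>

lemma bounded_near_bot:
  fixes f :: "real \<Rightarrow> real"
  assumes "(f \<longlongrightarrow> l) at_bot"
  shows "\<exists>a. bounded (f ` {..a})"
proof -
  have "\<forall>\<^sub>F t in at_bot. dist (f t) l < 1"
    using assms by (rule tendstoD) simp
  then obtain a where "\<And>t. t \<le> a \<Longrightarrow> dist (f t) l < 1"
    by (auto simp: eventually_at_bot_linorder)
  then have "f ` {..a} \<subseteq> cball l 1"
    by (force simp: dist_commute)
  then show ?thesis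
    using bounded_cball bounded_subset by blast
qed

lemma bounded_near_top:
  fixes f :: "real \<Rightarrow> real"
  assumes "(f \<longlongrightarrow> l) at_top"
  shows "\<exists>a. bounded (f ` {a..})"
proof -
  have "\<forall>\<^sub>F t in at_top. dist (f t) l < 1"
    using assms by (rule tendstoD) simp
  then obtain a where "\<And>t. t \<ge> a \<Longrightarrow> dist (f t) l < 1"
    by (auto simp: eventually_at_top_linorder)
  then have "f ` {a..} \<subseteq> cball l 1"
    by (force simp: dist_commute)
  then show ?thesis
    using bounded_cball bounded_subset by blast
qed

lemma bounded_near_point:
  fixes f :: "real \<Rightarrow> real"
  assumes "(f \<longlongrightarrow> l) (at_left x)" "(f \<longlongrightarrow> r) (at_right x)"
  shows "\<exists>d>0. bounded (f ` {x - d<..<x + d})"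
proof -
  have "\<forall>\<^sub>F t in at_left x. dist (f t) l < 1" "\<forall>\<^sub>F t in at_right x. dist (f t) r < 1"
    using assms by (auto intro: tendstoD)
  then obtain a b where ab: "a < x" "\<And>t. a < t \<Longrightarrow> t < x \<Longrightarrow> dist (f t) l < 1"
    "x < b" "\<And>t. x < t \<Longrightarrow> t < b \<Longrightarrow> dist (f t) r < 1"
    unfolding eventually_at_left_field eventually_at_right_field by blast
  \<comment> \<open>The value at \<open>x\<close> itself is not controlled by either one-sided
    limit, hence the extra singleton.\<close>
  have "f t \<in> cball l 1 \<union> cball r 1 \<union> {f x}" if "t \<in> {a<..<b}" for t
    using that ab(2)[of t] ab(4)[of t] by (cases t x rule: linorder_cases) (auto simp: dist_commute)
  then have "f ` {a<..<b} \<subseteq> cball l 1 \<union> cball r 1 \<union> {f x}"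
    by blast
  then have "bounded (f ` {a<..<b})"
    by (rule bounded_subset[rotated]) auto
  moreover have "{x - min (x - a) (b - x)<..<x + min (x - a) (b - x)} \<subseteq> {a<..<b}"
    by auto
  ultimately show ?thesis
    using ab(1,3) by (intro exI[of _ "min (x - a) (b - x)"]) (auto intro: bounded_subset)
qed

text \<open>The limits at both ends bound the function outside a compact interval; inside,
  compactness upgrades local boundedness.\<close>

lemma regulated_bounded:
  assumes "regulated F"
  shows "bounded (range (\<lambda>t. F (ereal t)))"
proof -
  let ?f = "\<lambda>t. F (ereal t)"
  obtain a where a: "bounded (?f ` {..a})"
    using assms bounded_near_bot[of ?f] by (auto simp: regulated_def)
  obtain b where b: "bounded (?f ` {b..})"
    using assms bounded_near_top[of ?f] by (auto simp: regulated_def)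
  have ab: "bounded (?f ` {a..b})"
  proof (cases "a \<le> b")
    case True
    then show ?thesis
    \<comment> \<open>Bisection: boundedness passes from two adjacent intervals to their union and
      holds on all short enough intervals around a given point.\<close>
    proof (induction rule: Bolzano)
      case (trans a b c)
      then have "{a..c} = {a..b} \<union> {b..c}"
        by auto
      with trans show ?case
        by (simp add: image_Un)
    next
      case (local x)
      obtain d where "d > 0" "bounded (?f ` {x - d<..<x + d})"
        using assms bounded_near_point[of ?f] unfolding regulated_def by blast
      moreover have "{u..v} \<subseteq> {x - d<..<x + d}" if "u \<le> x" "x \<le> v" "v - u < d" for u v
        using that by auto
      ultimately show ?case
        by (meson bounded_subset image_mono)
    qed
  qed auto
  have "UNIV = {..a} \<union> {a..b} \<union> {b..}"
    by auto
  then show ?thesis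
    using a b ab by (metis image_Un bounded_Un)
qed

text \<open>Norm and order look at real arguments only. Since the values at the two infinite points
  are limits, a bound on the reals extends to them.\<close>

lemma regulated_abs_le:
  assumes "regulated F" "\<And>t::real. \<bar>F (ereal t)\<bar> \<le> c"
  shows "\<bar>F y\<bar> \<le> c"
proof (cases y)
  case PInf
  have "((\<lambda>t. \<bar>F (ereal t)\<bar>) \<longlongrightarrow> \<bar>F \<infinity>\<bar>) at_top"
    using assms by (auto simp: regulated_def intro: tendsto_rabs)
  then show ?thesis
    using PInf assms(2) by (auto intro: tendsto_upperbound)
next
  case MInf
  have "((\<lambda>t. \<bar>F (ereal t)\<bar>) \<longlongrightarrow> \<bar>F (-\<infinity>)\<bar>) at_bot"
    using assms by (auto simp: regulated_def intro: tendsto_rabs)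
  then show ?thesis
    using MInf assms(2) by (auto intro: tendsto_upperbound)
qed (use assms in auto)

text \<open>The limits of the \<open>f n\<close> form a Cauchy sequence because the
  \<open>f n\<close> are uniformly Cauchy, and their limit is then the limit of \<open>g\<close>.
  This serves the one-sided limits in \<open>regulated\<close>, whose values are not
  prescribed.\<close>

lemma uniform_limit_tendsto_ex:
  fixes f :: "nat \<Rightarrow> real \<Rightarrow> real"
  assumes lim: "\<And>n. \<exists>l. (f n \<longlongrightarrow> l) F" and unif: "uniform_limit UNIV f g sequentially"
    and F: "F \<noteq> bot"
  shows "\<exists>l. (g \<longlongrightarrow> l) F"
proof -
  obtain l where l: "\<And>n. (f n \<longlongrightarrow> l n) F"
    using lim by metis
  have "Cauchy l"
  proof (rule metric_CauchyI)
    fix e :: real assume "e > 0"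
    then have "uniformly_Cauchy_on UNIV f"
      using unif by (meson uniformly_convergent_on_def uniformly_convergent_Cauchy)
    then obtain M where M: "\<And>x m n. M \<le> m \<Longrightarrow> M \<le> n \<Longrightarrow> dist (f m x) (f n x) < e / 2"
      using \<open>e > 0\<close> unfolding uniformly_Cauchy_on_def by (metis UNIV_I half_gt_zero)
    have "dist (l m) (l n) < e" if "M \<le> m" "M \<le> n" for m n
    proof -
      have "((\<lambda>x. dist (f m x) (f n x)) \<longlongrightarrow> dist (l m) (l n)) F"
        by (intro tendsto_dist l)
      then have "dist (l m) (l n) \<le> e / 2"
        by (rule tendsto_upperbound) (use M[OF that] F in \<open>auto intro: less_imp_le always_eventually\<close>)
      then show ?thesis
        using \<open>e > 0\<close> by simp
    qed
    then show "\<exists>M. \<forall>m\<ge>M. \<forall>n\<ge>M. dist (l m) (l n) < e"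
      by blast
  qed
  then obtain L where "l \<longlonglongrightarrow> L"
    using Cauchy_convergent convergent_def by blast
  then have "(g \<longlongrightarrow> L) F"
    using l unif by (intro swap_uniform_limit'[of f l F sequentially L UNIV g]) auto
  then show ?thesis ..
qed

text \<open>Every limit in question is \<open>F\<close> composed with a limit of the embedding
  \<open>ereal\<close>, which tends to the infinite points along \<open>at_top\<close> and
  \<open>at_bot\<close>.\<close>

lemma continuous_imp_regulated:
  assumes "continuous_on UNIV F"
  shows "regulated F" "(\<lambda>t. F (ereal t)) \<midarrow>x\<rightarrow> F (ereal x)"
proof -
  have F: "(F \<longlongrightarrow> F y) (at y)" for y
    using assms by (simp add: continuous_on_def)
  have lim: "((\<lambda>t. F (ereal t)) \<longlongrightarrow> F y) G" if "(ereal \<longlongrightarrow> y) G" for y G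
    by (rule tendsto_compose[OF F that])
  show "(\<lambda>t. F (ereal t)) \<midarrow>x\<rightarrow> F (ereal x)"
    by (intro lim tendsto_intros)
  have "((\<lambda>t. F (ereal t)) \<longlongrightarrow> F (ereal x)) (at_left x)" "((\<lambda>t. F (ereal t)) \<longlongrightarrow> F (ereal x)) (at_right x)" for x
    by (intro lim tendsto_intros)+
  moreover have "((\<lambda>t. F (ereal t)) \<longlongrightarrow> F \<infinity>) at_top" "((\<lambda>t. F (ereal t)) \<longlongrightarrow> F (-\<infinity>)) at_bot"
    by (intro lim; simp add: tendsto_PInfty tendsto_MInfty eventually_gt_at_top eventually_gt_at_bot)+
  ultimately show "regulated F"
    unfolding regulated_def by blast
qed

section \<open>Closure of the primitive spaces under linear operations, maxima and uniform
  limits\<close>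

lemma continuous_primitives_subset: "continuous_primitives \<subseteq> regulated_primitives"
  using continuous_imp_regulated
  by (force simp: continuous_primitives_def regulated_primitives_def
      intro: tendsto_mono[OF at_le[OF subset_UNIV]])

text \<open>Sums, scalar multiples and maxima are treated at once: all conditions on a primitive are
  limits along filters, and \<open>h\<close> preserves limits.\<close>

lemma regulated_primitives_combine:
  fixes h :: "real \<Rightarrow> real \<Rightarrow> real"
  assumes F: "F \<in> regulated_primitives" and G: "G \<in> regulated_primitives" and h0: "h 0 0 = 0"
    and h: "\<And>f g l m (A :: real filter).
      (f \<longlongrightarrow> l) A \<Longrightarrow> (g \<longlongrightarrow> m) A \<Longrightarrow> ((\<lambda>t. h (f t) (g t)) \<longlongrightarrow> h l m) A"
  shows "(\<lambda>x. h (F x) (G x)) \<in> regulated_primitives"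
proof -
  have ex: "\<exists>l. ((\<lambda>t. h (F (ereal t)) (G (ereal t))) \<longlongrightarrow> l) A"
    if "\<exists>l. ((\<lambda>t. F (ereal t)) \<longlongrightarrow> l) A" "\<exists>l. ((\<lambda>t. G (ereal t)) \<longlongrightarrow> l) A" for A
    using that h by blast
  show ?thesis
    unfolding regulated_primitives_def regulated_def mem_Collect_eq
    using F G unfolding regulated_primitives_def regulated_def mem_Collect_eq
    by (intro conjI allI ex h) (elim conjE allE, (assumption | simp add: h0))+
qed

lemma regulated_primitives_subspace: "subspace regulated_primitives"
proof (rule subspaceI)
  show "0 \<in> regulated_primitives"
    by (auto simp: regulated_primitives_def regulated_def)
  fix F G assume "F \<in> regulated_primitives" "G \<in> regulated_primitives"
  then show "F + G \<in> regulated_primitives"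
    unfolding plus_fun_def by (rule regulated_primitives_combine) (auto intro: tendsto_add)
  show "c *\<^sub>R F \<in> regulated_primitives" for c
    unfolding scaleR_fun_def
    \<comment> \<open>Scaling is a binary operation that ignores its second argument, so
      \<open>F\<close> is supplied twice.\<close>
    using \<open>F \<in> _\<close> \<open>F \<in> _\<close> by (rule regulated_primitives_combine) (auto intro: tendsto_mult_left)
qed

lemma regulated_primitives_max:
  assumes "F \<in> regulated_primitives" "G \<in> regulated_primitives"
  shows "(\<lambda>x. max (F x) (G x)) \<in> regulated_primitives"
  using assms by (rule regulated_primitives_combine) (auto intro: tendsto_max)

lemma regulated_primitives_uniform_limit:
  assumes X: "\<And>i. X i \<in> regulated_primitives" and lim: "uniform_limit UNIV X F sequentially"
  shows "F \<in> regulated_primitives"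
proof -
  let ?Y = "\<lambda>i t. X i (ereal t)" and ?f = "\<lambda>t. F (ereal t)"
  have pt: "(\<lambda>i. X i y) \<longlonglongrightarrow> F y" for y
    using lim by (rule tendsto_uniform_limitI) simp
  have unif: "uniform_limit UNIV ?Y ?f sequentially"
    using lim by (rule uniform_limit_compose') auto
  \<comment> \<open>\<open>swap\<close> handles limits with a prescribed value (at the infinite
    points and from the left), \<open>ex\<close> those that need only exist.\<close>
  have swap: "(?f \<longlongrightarrow> F y) G" if "\<And>i. (?Y i \<longlongrightarrow> X i y) G" "G \<noteq> bot" for y G
    using that pt[of y] unif
    by (intro swap_uniform_limit'[of ?Y "\<lambda>i. X i y" G sequentially "F y" UNIV ?f]) auto
  have ex: "\<exists>l. (?f \<longlongrightarrow> l) G" if "\<And>i. \<exists>l. (?Y i \<longlongrightarrow> l) G" "G \<noteq> bot" for G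
    using uniform_limit_tendsto_ex[of ?Y G ?f] that unif by blast
  have "regulated F"
    using X unfolding regulated_def regulated_primitives_def
    by (auto intro!: ex swap)
  moreover have "F (-\<infinity>) = 0"
    using pt[of "-\<infinity>"] X by (simp add: regulated_primitives_def LIMSEQ_const_iff)
  moreover have "(?f \<longlongrightarrow> F (ereal x)) (at_left x)" for x
    using X by (intro swap) (auto simp: regulated_primitives_def)
  ultimately show ?thesis
    by (simp add: regulated_primitives_def)
qed

lemma continuous_primitives_subspace: "subspace continuous_primitives"
  by (rule subspaceI)
    (auto simp: continuous_primitives_def zero_fun_def plus_fun_def scaleR_fun_def
      intro!: continuous_intros)

lemma continuous_primitives_max:
  assumes "F \<in> continuous_primitives" "G \<in> continuous_primitives"
  shows "(\<lambda>x. max (F x) (G x)) \<in> continuous_primitives"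
  using assms by (auto simp: continuous_primitives_def intro!: continuous_on_max)

lemma continuous_primitives_uniform_limit:
  assumes X: "\<And>i. X i \<in> continuous_primitives" and lim: "uniform_limit UNIV X F sequentially"
  shows "F \<in> continuous_primitives"
proof -
  have "continuous_on UNIV F"
    using X by (intro uniform_limit_theorem[OF _ lim]) (auto simp: continuous_primitives_def)
  moreover have "(\<lambda>i. X i (-\<infinity>)) \<longlonglongrightarrow> F (-\<infinity>)"
    using lim by (rule tendsto_uniform_limitI) simp
  then have "F (-\<infinity>) = 0"
    using X by (simp add: continuous_primitives_def LIMSEQ_const_iff)
  ultimately show ?thesis
    by (simp add: continuous_primitives_def)
qed

section \<open>The sup norm\<close>

abbreviation sup_norm :: "(ereal \<Rightarrow> real) \<Rightarrow> real" where
  "sup_norm F \<equiv> SUP x::real. \<bar>F (ereal x)\<bar>"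

lemma sup_norm_le:
  assumes "\<And>x::real. \<bar>F (ereal x)\<bar> \<le> c"
  shows "sup_norm F \<le> c"
  by (rule cSUP_least) (use assms in auto)

text \<open>A real supremum is an upper bound only for sets that are bounded above, which is what
  \<open>regulated_bounded\<close> provides.\<close>

lemma abs_le_sup_norm:
  assumes "F \<in> regulated_primitives"
  shows "\<bar>F y\<bar> \<le> sup_norm F"
proof (rule regulated_abs_le)
  show "regulated F"
    using assms by (simp add: regulated_primitives_def)
  then have "bdd_above (range (\<lambda>x::real. \<bar>F (ereal x)\<bar>))"
    using regulated_bounded[of F] by (fastforce simp: bounded_iff bdd_above_def)
  then show "\<bar>F (ereal t)\<bar> \<le> sup_norm F" for t
    by (rule cSUP_upper[OF UNIV_I])
qed

lemma sup_norm_eqI: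
  assumes "\<And>x::real. \<bar>F (ereal x)\<bar> \<le> c" "F \<in> regulated_primitives" "\<bar>F y\<bar> = c"
  shows "sup_norm F = c"
  using sup_norm_le[of F c, OF assms(1)] abs_le_sup_norm[OF assms(2), of y] assms(3) by simp

text \<open>These four properties are shared by the regulated and the continuous primitives, so both
  spaces are treated in one argument. The inclusion supplies boundedness, the last property
  completeness.\<close>

locale primitives_lattice =
  fixes C :: "(ereal \<Rightarrow> real) set"
  assumes subset: "C \<subseteq> regulated_primitives"
    and subspace: "subspace C"
    and max: "\<And>F G. F \<in> C \<Longrightarrow> G \<in> C \<Longrightarrow> (\<lambda>x. max (F x) (G x)) \<in> C"
    and uniform_limit:
      "\<And>X F. (\<And>i. X i \<in> C) \<Longrightarrow> uniform_limit UNIV X F sequentially \<Longrightarrow> F \<in> C"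
begin

abbreviation L where "L \<equiv> sup_norm_space C"

lemma sup_norm_space_sel [simp]:
  "carrier L = C" "(F .=\<^bsub>L\<^esub> G) = (F = G)"
  "(F \<sqsubseteq>\<^bsub>L\<^esub> G) = (\<forall>x::real. F (ereal x) \<le> G (ereal x))"
  "nrm L F = sup_norm F"
  by (simp_all add: sup_norm_space_def)

lemma closed [simp]:
  "0 \<in> C" "F \<in> C \<Longrightarrow> G \<in> C \<Longrightarrow> F + G \<in> C" "F \<in> C \<Longrightarrow> c *\<^sub>R F \<in> C" "F \<in> C \<Longrightarrow> - F \<in> C"
  "F \<in> C \<Longrightarrow> G \<in> C \<Longrightarrow> F - G \<in> C"
  using subspace by (auto simp: subspace_0 subspace_add subspace_scale subspace_diff subspace_neg)

lemma min: "F \<in> C \<Longrightarrow> G \<in> C \<Longrightarrow> (\<lambda>x. min (F x) (G x)) \<in> C"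
proof -
  assume "F \<in> C" "G \<in> C"
  then have "- (\<lambda>x. max ((- F) x) ((- G) x)) \<in> C"
    by (intro closed max)
  also have "- (\<lambda>x. max ((- F) x) ((- G) x)) = (\<lambda>x. min (F x) (G x))"
    by (auto simp: fun_eq_iff)
  finally show ?thesis .
qed

lemma abs_le: "F \<in> C \<Longrightarrow> \<bar>F y\<bar> \<le> sup_norm F"
  using subset by (blast intro: abs_le_sup_norm)

text \<open>This yields antisymmetry of the order, which compares values on the reals only.\<close>

lemma eqI:
  assumes "F \<in> C" "G \<in> C" "\<And>x::real. F (ereal x) = G (ereal x)"
  shows "F = G"
proof
  fix y
  have "F - G \<in> C"
    using assms by simp
  then have "regulated (F - G)"
    using subset by (auto simp: regulated_primitives_def)
  then have "\<bar>(F - G) y\<bar> \<le> 0"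
    by (rule regulated_abs_le) (use assms in simp)
  then show "F y = G y"
    by simp
qed

sublocale partial_order L
proof
  show "F .=\<^bsub>L\<^esub> G" if "F \<sqsubseteq>\<^bsub>L\<^esub> G" "G \<sqsubseteq>\<^bsub>L\<^esub> F" "F \<in> carrier L" "G \<in> carrier L" for F G
    using that eqI[of F G] by (auto intro: antisym)
qed (auto intro: order_trans simp: fun_eq_iff)

sublocale lattice L
proof
  fix F G assume FG: "F \<in> carrier L" "G \<in> carrier L"
  have "least L (\<lambda>x. max (F x) (G x)) (Upper L {F, G})"
    using FG by (simp add: least_Upper_pair_iff max)
  then show "\<exists>s. least L s (Upper L {F, G})"
    by blast
  have "greatest L (\<lambda>x. min (F x) (G x)) (Lower L {F, G})"
    using FG by (simp add: greatest_Lower_pair_iff min)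
  then show "\<exists>s. greatest L s (Lower L {F, G})"
    by blast
qed

lemma join_eq: "F \<in> C \<Longrightarrow> G \<in> C \<Longrightarrow> F \<squnion>\<^bsub>L\<^esub> G = (\<lambda>x. max (F x) (G x))"
  by (rule join_eqI) (simp_all add: max)

lemma sup_norm_scaleR:
  assumes "F \<in> C"
  shows "sup_norm (c *\<^sub>R F) = \<bar>c\<bar> * sup_norm F"
proof (rule antisym)
  have le: "sup_norm (c *\<^sub>R F) \<le> \<bar>c\<bar> * sup_norm F" if "F \<in> C" for c F
    using abs_le[OF that] by (intro sup_norm_le) (simp add: abs_mult mult_left_mono)
  show "sup_norm (c *\<^sub>R F) \<le> \<bar>c\<bar> * sup_norm F"
    using assms by (rule le)
  show "\<bar>c\<bar> * sup_norm F \<le> sup_norm (c *\<^sub>R F)"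
  proof (cases "c = 0")
    case False
    \<comment> \<open>The reverse inequality is the first one applied to
      \<open>c *\<^sub>R F\<close> and the inverse scalar.\<close>
    then have "sup_norm F \<le> \<bar>inverse c\<bar> * sup_norm (c *\<^sub>R F)"
      using le[of "c *\<^sub>R F" "inverse c"] assms by simp
    then show ?thesis
      using False by (simp add: field_simps)
  qed (use assms abs_le[of "0 *\<^sub>R F"] in simp)
qed

lemma sup_norm_complete:
  assumes X: "\<And>i. X i \<in> C"
    and Cauchy: "\<And>e. e > 0 \<Longrightarrow> \<exists>N. \<forall>i\<ge>N. \<forall>j\<ge>N. sup_norm (X i - X j) < e"
  shows "\<exists>F\<in>C. (\<lambda>i. sup_norm (X i - F)) \<longlonglongrightarrow> 0"
proof -
  have "uniformly_Cauchy_on UNIV X"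
    unfolding uniformly_Cauchy_on_def dist_real_def
  proof (intro allI impI)
    fix e :: real assume "e > 0"
    then obtain N where "\<forall>i\<ge>N. \<forall>j\<ge>N. sup_norm (X i - X j) < e"
      using Cauchy by blast
    moreover have "\<bar>X i y - X j y\<bar> \<le> sup_norm (X i - X j)" for i j y
      using abs_le[of "X i - X j" y] X by simp
    ultimately show "\<exists>M. \<forall>y\<in>UNIV. \<forall>i\<ge>M. \<forall>j\<ge>M. \<bar>X i y - X j y\<bar> < e"
      by (meson order_le_less_trans)
  qed
  then obtain F where F: "uniform_limit UNIV X F sequentially"
    using Cauchy_uniformly_convergent uniformly_convergent_on_def by blast
  have "(\<lambda>i. sup_norm (X i - F)) \<longlonglongrightarrow> 0"
  proof (rule LIMSEQ_I)
    fix e :: real assume "e > 0"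
    \<comment> \<open>Half of \<open>e\<close> is used because strict pointwise bounds give only a
      weak bound on the supremum.\<close>
    then have "\<forall>\<^sub>F i in sequentially. \<forall>y\<in>UNIV. dist (X i y) (F y) < e / 2"
      by (intro uniform_limitD[OF F]) simp
    then obtain N where N: "\<And>i y. i \<ge> N \<Longrightarrow> \<bar>X i y - F y\<bar> < e / 2"
      by (auto simp: eventually_sequentially dist_real_def)
    have "norm (sup_norm (X i - F) - 0) < e" if "i \<ge> N" for i
    proof -
      have "sup_norm (X i - F) \<le> e / 2"
        using N[OF that] by (intro sup_norm_le) (simp add: less_imp_le)
      moreover have "0 \<le> sup_norm (X i - F)"
        using abs_le[of "X i - F" 0] X uniform_limit[OF X F] by force
      ultimately show ?thesis
        using \<open>e > 0\<close> by simp
    qed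
    then show "\<exists>N. \<forall>i\<ge>N. norm (sup_norm (X i - F) - 0) < e"
      by blast
  qed
  then show ?thesis
    using uniform_limit[OF X F] by blast
qed

theorem abstract_M_space: "abstract_M_space L"
proof
  show "subspace (carrier L)"
    by (simp add: subspace)
next
  fix F assume "F \<in> carrier L"
  then have F: "F \<in> C"
    by simp
  show nonneg: "0 \<le> nrm L F"
    using abs_le[OF F, of 0] by simp
  show "nrm L F = 0 \<longleftrightarrow> F = 0"
  proof
    assume "nrm L F = 0"
    then show "F = 0"
      using abs_le[OF F] by (simp add: fun_eq_iff)
  qed simp
  show "nrm L (c *\<^sub>R F) = \<bar>c\<bar> * nrm L F" for c
    using sup_norm_scaleR[OF F] by simp
  fix G assume "G \<in> carrier L"
  then have G: "G \<in> C"
    by simp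
  show "nrm L (F + G) \<le> nrm L F + nrm L G"
    unfolding sup_norm_space_sel
  proof (rule sup_norm_le)
    fix x :: real
    show "\<bar>(F + G) (ereal x)\<bar> \<le> sup_norm F + sup_norm G"
      using abs_le[OF F, of x] abs_le[OF G, of x] by simp
  qed
  show "nrm L F \<le> nrm L G" if "F \<squnion>\<^bsub>L\<^esub> - F \<sqsubseteq>\<^bsub>L\<^esub> G \<squnion>\<^bsub>L\<^esub> - G"
    unfolding sup_norm_space_sel
  proof (rule sup_norm_le)
    fix x :: real
    \<comment> \<open>Joins are pointwise maxima, so the join of \<open>F\<close> and
      \<open>- F\<close> is the pointwise absolute value.\<close>
    have "\<bar>F (ereal x)\<bar> \<le> \<bar>G (ereal x)\<bar>"
      using that F G by (auto simp: join_eq abs_if max_def split: if_splits elim!: allE[of _ x])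
    then show "\<bar>F (ereal x)\<bar> \<le> sup_norm G"
      using abs_le[OF G, of x] by simp
  qed
  show "nrm L (F \<squnion>\<^bsub>L\<^esub> G) = max (nrm L F) (nrm L G)" if "0 \<sqsubseteq>\<^bsub>L\<^esub> F" "0 \<sqsubseteq>\<^bsub>L\<^esub> G"
  proof (rule antisym)
    have FG: "(\<lambda>x. max (F x) (G x)) \<in> C"
      using F G by (rule max)
    show "nrm L (F \<squnion>\<^bsub>L\<^esub> G) \<le> max (nrm L F) (nrm L G)"
      unfolding sup_norm_space_sel
    proof (rule sup_norm_le)
      fix x :: real
      show "\<bar>(F \<squnion>\<^bsub>L\<^esub> G) (ereal x)\<bar> \<le> max (sup_norm F) (sup_norm G)"
        using abs_le[OF F, of x] abs_le[OF G, of x] F G by (auto simp: join_eq)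
    qed
    \<comment> \<open>To be applied to \<open>F\<close> and to \<open>G\<close> in place of
      \<open>H\<close>.\<close>
    have "sup_norm H \<le> sup_norm (\<lambda>x. max (F x) (G x))"
      if "\<And>x::real. 0 \<le> H (ereal x)" "\<And>x::real. H (ereal x) \<le> max (F (ereal x)) (G (ereal x))" for H
    proof (rule sup_norm_le)
      show "\<bar>H (ereal x)\<bar> \<le> sup_norm (\<lambda>x. max (F x) (G x))" for x
        using that[of x] abs_le[OF FG, of x] by linarith
    qed
    then show "max (nrm L F) (nrm L G) \<le> nrm L (F \<squnion>\<^bsub>L\<^esub> G)"
      using that F G by (simp add: join_eq)
  qed
next
  show "\<exists>F\<in>carrier L. (\<lambda>i. nrm L (X i - F)) \<longlonglongrightarrow> 0"
    if "range X \<subseteq> carrier L" "\<forall>e>0. \<exists>N. \<forall>i\<ge>N. \<forall>j\<ge>N. nrm L (X i - X j) < e" for X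
    using that sup_norm_complete[of X] by (auto simp: image_subset_iff)
qed (auto simp: mult_left_mono)

end

section \<open>Smooth bump functions\<close>

text \<open>A finite order makes smoothness accessible to induction. Order \<open>n\<close> means
  \<open>n + 1\<close> derivatives, since the derivative of index \<open>n\<close> must itself be
  differentiable.\<close>

definition times_differentiable :: "nat \<Rightarrow> (real \<Rightarrow> real) \<Rightarrow> bool" where
  "times_differentiable n f \<longleftrightarrow> (\<forall>k\<le>n. (deriv ^^ k) f differentiable_on UNIV)"

lemma differentiable_on_UNIV_iff:
  fixes f :: "real \<Rightarrow> real"
  shows "f differentiable_on UNIV \<longleftrightarrow> (\<forall>x. (f has_real_derivative deriv f x) (at x))"
  by (auto simp: differentiable_on_def DERIV_deriv_iff_real_differentiable)

lemma differentiable_on_UNIV_I: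
  "(\<And>x. (f has_real_derivative f' x) (at x)) \<Longrightarrow> f differentiable_on UNIV"
  using real_differentiable_def differentiable_on_def by blast

lemma times_differentiable_0: "times_differentiable 0 f \<longleftrightarrow> f differentiable_on UNIV"
  by (simp add: times_differentiable_def)

lemma times_differentiable_Suc:
  "times_differentiable (Suc n) f \<longleftrightarrow> f differentiable_on UNIV \<and> times_differentiable n (deriv f)"
  by (simp add: times_differentiable_def less_Suc_eq_le[symmetric] All_less_Suc2
      funpow_Suc_right del: funpow.simps(2))

lemma times_differentiable_SucI:
  assumes "\<And>x. (f has_real_derivative f' x) (at x)" "times_differentiable n f'"
  shows "times_differentiable (Suc n) f"
proof -
  have "deriv f = f'"
    using assms(1) by (auto intro: DERIV_imp_deriv)
  then show ?thesis
    using assms(2) differentiable_on_UNIV_I[of f f', OF assms(1)]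
    by (simp add: times_differentiable_Suc)
qed

lemma times_differentiable_SucD: "times_differentiable (Suc n) f \<Longrightarrow> times_differentiable n f"
  by (simp add: times_differentiable_def)

lemma times_differentiable_add:
  "times_differentiable n f \<Longrightarrow> times_differentiable n g \<Longrightarrow> times_differentiable n (\<lambda>x. f x + g x)"
proof (induction n arbitrary: f g)
  case (Suc n)
  then show ?case
    by (intro times_differentiable_SucI[where f' = "\<lambda>x. deriv f x + deriv g x"])
      (auto simp: times_differentiable_Suc differentiable_on_UNIV_iff intro!: derivative_intros)
qed (simp add: times_differentiable_0 differentiable_on_add)

lemma times_differentiable_mult:
  "times_differentiable n f \<Longrightarrow> times_differentiable n g \<Longrightarrow> times_differentiable n (\<lambda>x. f x * g x)"
proof (induction n arbitrary: f g)
  case (Suc n)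
  \<comment> \<open>The product rule also contains the undifferentiated factors, which are needed at
    the lower order.\<close>
  then have "times_differentiable n f" "times_differentiable n g"
    by (simp_all add: times_differentiable_SucD)
  with Suc show ?case
    by (intro times_differentiable_SucI[where f' = "\<lambda>x. deriv f x * g x + f x * deriv g x"]
        times_differentiable_add)
      (auto simp: times_differentiable_Suc differentiable_on_UNIV_iff intro!: derivative_eq_intros)
qed (simp add: times_differentiable_0 differentiable_on_mult)

lemma times_differentiable_const: "times_differentiable n (\<lambda>x. c)"
proof (induction n arbitrary: c)
  case (Suc n)
  show ?case
    by (rule times_differentiable_SucI[OF DERIV_const Suc])
qed (simp add: times_differentiable_0)

lemma has_derivative_affine:
  fixes f :: "real \<Rightarrow> real"
  assumes "(f has_real_derivative D) (at (c * x + d))"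
  shows "((\<lambda>x. f (c * x + d)) has_real_derivative D * c) (at x)"
  using assms by (rule DERIV_chain2) (auto intro!: derivative_eq_intros)

text \<open>The slope \<open>c\<close> admits the reflection \<open>b - x\<close> in
  \<open>bump\<close>; slope 1 gives translates.\<close>

lemma times_differentiable_affine:
  "times_differentiable n f \<Longrightarrow> times_differentiable n (\<lambda>x. f (c * x + d))"
proof (induction n arbitrary: f)
  case 0
  then have "(f has_real_derivative deriv f x) (at x)" for x
    by (simp add: times_differentiable_0 differentiable_on_UNIV_iff)
  then have "((\<lambda>x. f (c * x + d)) has_real_derivative deriv f (c * x + d) * c) (at x)" for x
    by (intro has_derivative_affine)
  then show ?case
    unfolding times_differentiable_0 by (rule differentiable_on_UNIV_I)
next
  case (Suc n)
  then have "(f has_real_derivative deriv f x) (at x)" for x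
    by (simp add: times_differentiable_Suc differentiable_on_UNIV_iff)
  moreover have "times_differentiable n (\<lambda>x. deriv f (c * x + d) * c)"
    using Suc by (intro times_differentiable_mult times_differentiable_const)
      (simp add: times_differentiable_Suc)
  ultimately show ?case
    by (intro times_differentiable_SucI[where f' = "\<lambda>x. deriv f (c * x + d) * c"]
        has_derivative_affine)
qed

section \<open>The smooth function exp(-1/x), extended by 0, and its derivatives\<close>

definition flat :: "real poly \<Rightarrow> real \<Rightarrow> real" where
  "flat p x = (if 0 < x then poly p (1 / x) * exp (- (1 / x)) else 0)"

lemma poly_times_exp_tendsto_0: "((\<lambda>y. poly p y * exp (- y)) \<longlongrightarrow> (0::real)) at_top"
proof -
  have "((\<lambda>y. \<Sum>i\<le>degree p. coeff p i * (y ^ i / exp y)) \<longlongrightarrow> (\<Sum>i\<le>degree p. coeff p i * 0)) at_top"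
    by (intro tendsto_intros tendsto_power_div_exp_0)
  moreover have "(\<Sum>i\<le>degree p. coeff p i * (y ^ i / exp y)) = poly p y * exp (- y)" for y :: real
    by (simp only: poly_altdef exp_minus divide_inverse sum_distrib_right mult.assoc)
  ultimately show ?thesis
    by (simp only: mult_zero_right sum.neutral_const)
qed

text \<open>With \<open>y = 1 / x\<close>, differentiating p(y) exp(-y) gives y^2 (p - p')(y)
  exp(-y). The family is thus closed under differentiation, which is why \<open>flat\<close> carries
  a polynomial.\<close>

lemma flat_has_derivative:
  "(flat p has_real_derivative flat ([:0, 0, 1:] * (p - pderiv p)) x) (at x)"
proof (cases x "0 :: real" rule: linorder_cases)
  case greater
  define y where "y = 1 / x"
  have inv: "((\<lambda>x. 1 / x) has_real_derivative - (y * y)) (at x)"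
    using greater by (auto intro!: derivative_eq_intros simp: y_def power2_eq_square)
  have "((\<lambda>x. poly p (1 / x)) has_real_derivative poly (pderiv p) y * - (y * y)) (at x)"
    using DERIV_chain2[OF poly_DERIV inv] by (simp add: y_def)
  moreover have "((\<lambda>x. exp (- (1 / x))) has_real_derivative exp (- y) * (y * y)) (at x)"
    using DERIV_chain2[OF DERIV_exp DERIV_minus[OF inv]] by (simp add: y_def)
  ultimately have "((\<lambda>x. poly p (1 / x) * exp (- (1 / x))) has_real_derivative
      poly (pderiv p) y * - (y * y) * exp (- y) + exp (- y) * (y * y) * poly p y) (at x)"
    unfolding y_def by (rule DERIV_mult)
  moreover have "poly (pderiv p) y * - (y * y) * exp (- y) + exp (- y) * (y * y) * poly p y
      = flat ([:0, 0, 1:] * (p - pderiv p)) x"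
  proof -
    have "flat ([:0, 0, 1:] * (p - pderiv p)) x
        = poly ([:0, 0, 1:] * (p - pderiv p)) y * exp (- y)"
      using greater by (simp only: flat_def y_def if_True)
    also have "\<dots> = (y * y) * (poly p y - poly (pderiv p) y) * exp (- y)"
      by (simp only: poly_mult poly_diff poly_pCons poly_0 mult_zero_right add_0 add_0_right
          mult_1_right mult_1)
    finally show ?thesis
      by (simp add: algebra_simps)
  qed
  ultimately have deriv: "((\<lambda>x. poly p (1 / x) * exp (- (1 / x))) has_real_derivative
      flat ([:0, 0, 1:] * (p - pderiv p)) x) (at x)"
    by (simp only:)
  have "\<forall>\<^sub>F y in nhds x. flat p y = poly p (1 / y) * exp (- (1 / y))"
    by (rule eventually_mono[OF eventually_nhds_in_open[OF open_greaterThan, of x 0]])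
      (use greater in \<open>simp_all add: flat_def\<close>)
  from DERIV_cong_ev[OF refl this refl] deriv show ?thesis
    by (simp only:)
next
  case less
  have deriv: "((\<lambda>_. 0) has_real_derivative flat ([:0, 0, 1:] * (p - pderiv p)) x) (at x)"
    using less by (simp add: flat_def)
  have "\<forall>\<^sub>F y in nhds x. flat p y = 0"
    by (rule eventually_mono[OF eventually_nhds_in_open[OF open_lessThan, of x 0]])
      (use less in \<open>simp_all add: flat_def\<close>)
  from DERIV_cong_ev[OF refl this refl] deriv show ?thesis
    by (simp only:)
next
  case equal
  \<comment> \<open>\<open>pCons 0 p\<close> is the polynomial y p(y); the extra factor absorbs the
    division by \<open>h\<close> in the difference quotient at 0.\<close>
  have "((\<lambda>h. poly (pCons 0 p) (inverse h) * exp (- inverse h)) \<longlongrightarrow> 0) (at_right 0)"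
    by (rule filterlim_compose[OF poly_times_exp_tendsto_0 filterlim_inverse_at_top_right])
  moreover have "\<forall>\<^sub>F h in at_right 0. flat p h / h = poly (pCons 0 p) (inverse h) * exp (- inverse h)"
    by (rule eventually_at_right_less[THEN eventually_mono]) (simp add: flat_def divide_inverse)
  ultimately have "((\<lambda>h. flat p h / h) \<longlongrightarrow> 0) (at_right 0)"
    by (simp add: tendsto_cong)
  moreover have "\<forall>\<^sub>F h in at_left 0. flat p h / h = 0"
    by (rule eventually_at_leftI[of "-1"]) (auto simp: flat_def)
  then have "((\<lambda>h. flat p h / h) \<longlongrightarrow> 0) (at_left 0)"
    by (rule tendsto_eventually)
  ultimately have "((\<lambda>h. flat p h / h) \<longlongrightarrow> 0) (at 0)"
    by (simp only: filterlim_at_split)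
  then have "(flat p has_real_derivative 0) (at 0)"
    by (simp add: DERIV_def flat_def)
  then show ?thesis
    using equal by (simp add: flat_def)
qed

lemma times_differentiable_flat: "times_differentiable n (flat p)"
proof (induction n arbitrary: p)
  case 0
  show ?case
    unfolding times_differentiable_0 by (rule differentiable_on_UNIV_I[OF flat_has_derivative])
next
  case (Suc n)
  show ?case
    by (rule times_differentiable_SucI[OF flat_has_derivative Suc])
qed

definition bump :: "real \<Rightarrow> real \<Rightarrow> real \<Rightarrow> real" where
  "bump a b x = flat 1 (x - a) * flat 1 (b - x)"

lemma bump_pos_iff: "0 < bump a b x \<longleftrightarrow> a < x \<and> x < b"
  and bump_nonneg: "0 \<le> bump a b x"
  and bump_eq_0: "x \<notin> {a<..<b} \<Longrightarrow> bump a b x = 0"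
  by (auto simp: bump_def flat_def)

lemma is_test_funI:
  assumes "\<And>n. times_differentiable n \<phi>" "\<And>x. x \<notin> {a..b} \<Longrightarrow> \<phi> x = 0"
  shows "is_test_fun \<phi>"
proof -
  have "(deriv ^^ k) \<phi> differentiable_on UNIV" for k
    using assms(1)[of k] by (simp add: times_differentiable_def)
  moreover have "{x. \<phi> x \<noteq> 0} \<subseteq> {a..b}"
    using assms(2) by blast
  then have "compact (closure {x. \<phi> x \<noteq> 0})"
    by (meson bounded_closed_interval bounded_subset compact_closure)
  ultimately show ?thesis
    by (simp add: is_test_fun_def)
qed

lemma is_test_fun_times_differentiable: "is_test_fun \<phi> \<Longrightarrow> times_differentiable n \<phi>"
  by (simp add: is_test_fun_def times_differentiable_def)

lemma is_test_fun_bump: "is_test_fun (bump a b)"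
proof (rule is_test_funI)
  show "times_differentiable n (bump a b)" for n
    using times_differentiable_mult[OF times_differentiable_affine[OF times_differentiable_flat, of n 1 1 "- a"]
        times_differentiable_affine[OF times_differentiable_flat, of n 1 "- 1" b]]
    unfolding bump_def[abs_def] by simp
  show "bump a b x = 0" if "x \<notin> {a..b}" for x
    using that by (intro bump_eq_0) auto
qed

section \<open>Test functions\<close>

lemma is_test_fun_has_derivative:
  assumes "is_test_fun \<phi>"
  shows "(\<phi> has_real_derivative deriv \<phi> x) (at x)"
proof -
  have "(deriv ^^ 0) \<phi> differentiable_on UNIV"
    using assms unfolding is_test_fun_def by blast
  then show ?thesis
    by (simp add: differentiable_on_UNIV_iff)
qed

lemma is_test_fun_support:
  assumes "is_test_fun \<phi>"
  shows "\<exists>a b. \<forall>x. x \<notin> {a..b} \<longrightarrow> \<phi> x = 0"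
proof -
  have "bounded {x. \<phi> x \<noteq> 0}"
    using assms by (simp add: is_test_fun_def)
  then obtain a b where "{x. \<phi> x \<noteq> 0} \<subseteq> cbox a b"
    using bounded_subset_cbox_symmetric by metis
  then show ?thesis
    by (intro exI[of _ a] exI[of _ b]) auto
qed

lemma is_test_fun_antiderivative:
  assumes "\<And>x. (\<phi> has_real_derivative \<psi> x) (at x)" "is_test_fun \<psi>"
    and "\<And>x. x \<notin> {a..b} \<Longrightarrow> \<phi> x = 0"
  shows "is_test_fun \<phi>"
proof (rule is_test_funI)
  show "times_differentiable n \<phi>" for n
    using times_differentiable_SucI[of \<phi> \<psi> n, OF assms(1)] assms(2)
    by (simp add: is_test_fun_times_differentiable times_differentiable_SucD)
qed (fact assms(3))

section \<open>Translates of test functions\<close>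

lemma higher_deriv_shift:
  fixes \<phi> :: "real \<Rightarrow> real"
  assumes "\<And>k. (deriv ^^ k) \<phi> differentiable_on UNIV"
  shows "(deriv ^^ k) (\<lambda>x. \<phi> (x + h)) = (\<lambda>x. (deriv ^^ k) \<phi> (x + h))"
proof (induction k)
  case (Suc k)
  have "((deriv ^^ k) \<phi> has_real_derivative (deriv ^^ Suc k) \<phi> (x + h)) (at (x + h))" for x
    using assms[of k] by (simp add: differentiable_on_UNIV_iff)
  then have "((\<lambda>x. (deriv ^^ k) \<phi> (x + h)) has_real_derivative (deriv ^^ Suc k) \<phi> (x + h)) (at x)" for x
    by (simp add: DERIV_shift)
  then show ?case
    by (simp add: Suc.IH fun_eq_iff DERIV_imp_deriv)
qed simp

lemma is_test_fun_shift:
  assumes "is_test_fun \<phi>"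
  shows "is_test_fun (\<lambda>x. \<phi> (x + h))"
proof -
  obtain a b where "\<And>x. x \<notin> {a..b} \<Longrightarrow> \<phi> x = 0"
    using is_test_fun_support[OF assms] by blast
  then have "\<phi> (x + h) = 0" if "x \<notin> {a - h..b - h}" for x
    using that by (simp add: algebra_simps)
  moreover have "times_differentiable n (\<lambda>x. \<phi> (x + h))" for n
    using times_differentiable_affine[of n \<phi> 1 h] assms
    by (simp add: is_test_fun_times_differentiable)
  ultimately show ?thesis
    by (intro is_test_funI)
qed

lift_definition test_shift :: "real \<Rightarrow> test_fun \<Rightarrow> test_fun" is "\<lambda>h \<phi> x. \<phi> (x + h)"
  by (rule is_test_fun_shift)

lemma test_deriv_shift: "test_deriv (test_shift h \<phi>) = test_shift h (test_deriv \<phi>)"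
proof (transfer fixing: h)
  fix \<phi> :: "real \<Rightarrow> real" assume "is_test_fun \<phi>"
  then show "deriv (\<lambda>x. \<phi> (x + h)) = (\<lambda>x. deriv \<phi> (x + h))"
    using higher_deriv_shift[of \<phi> 1 h] by (simp add: is_test_fun_def)
qed

lemma test_fun_continuous: "continuous_on A (test_app \<phi>)"
  using DERIV_isCont[OF is_test_fun_has_derivative[OF test_app[THEN CollectD]]]
  by (simp add: continuous_at_imp_continuous_on)

lemma test_app_diff: "test_app (\<phi> - \<psi>) x = test_app \<phi> x - test_app \<psi> x"
  unfolding minus_test_fun_def uminus_test_fun_def plus_test_fun.rep_eq scaleR_test_fun.rep_eq
  by simp

text \<open>An antiderivative \<open>\<Psi>\<close> of \<open>\<psi>\<close> may fail to have
  compact support, but it is constant on either side of the support of \<open>\<psi>\<close>. Hence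
  the difference of \<open>\<Psi>\<close> and its translate has compact support.\<close>

lemma ex_test_deriv_eq_shift_diff: "\<exists>\<theta>. test_deriv \<theta> = test_shift h \<psi> - \<psi>"
proof -
  have "\<exists>\<Psi>. \<forall>x::real. - \<infinity> < ereal x \<longrightarrow> ereal x < \<infinity> \<longrightarrow>
      (\<Psi> has_vector_derivative test_app \<psi> x) (at x)"
    using test_fun_continuous[of UNIV \<psi>]
    by (intro einterval_antiderivative) (simp_all add: continuous_on_eq_continuous_at)
  then obtain \<Psi> where \<Psi>: "(\<Psi> has_real_derivative test_app \<psi> x) (at x)" for x
    by (auto simp: has_real_derivative_iff_has_vector_derivative)
  obtain a b where ab: "\<And>x. x \<notin> {a..b} \<Longrightarrow> test_app \<psi> x = 0"
    using is_test_fun_support[OF test_app[of \<psi>, THEN CollectD]] by blast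
  have const: "\<exists>c. \<forall>x\<in>S. \<Psi> x = c" if "convex S" "S \<inter> {a..b} = {}" for S
  proof (rule has_field_derivative_zero_constant[OF \<open>convex S\<close>])
    fix x assume "x \<in> S"
    then have "test_app \<psi> x = 0"
      using that by (intro ab) auto
    then show "(\<Psi> has_real_derivative 0) (at x within S)"
      using \<Psi>[of x] by (simp add: has_field_derivative_at_within)
  qed
  have "convex {..<a}" "{..<a} \<inter> {a..b} = {}" "convex {b<..}" "{b<..} \<inter> {a..b} = {}"
    by auto
  then obtain c d where c: "\<forall>x\<in>{..<a}. \<Psi> x = c" and d: "\<forall>x\<in>{b<..}. \<Psi> x = d"
    using const by meson
  define \<theta> where "\<theta> x = \<Psi> (x + h) - \<Psi> x" for x
  have deriv: "(\<theta> has_real_derivative test_app (test_shift h \<psi> - \<psi>) x) (at x)" for x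
  proof -
    have "(\<theta> has_real_derivative test_app \<psi> (x + h) - test_app \<psi> x) (at x)"
      unfolding \<theta>_def[abs_def] using \<Psi>[of "x + h"] \<Psi>[of x]
      by (intro DERIV_diff) (simp_all add: DERIV_shift)
    then show ?thesis
      by (simp add: test_app_diff test_shift.rep_eq)
  qed
  have "is_test_fun \<theta>"
  \<comment> \<open>Outside the interval widened by \<open>\<bar>h\<bar>\<close>, the points
    \<open>x\<close> and \<open>x + h\<close> lie on the same side of the support, where
    \<open>\<Psi>\<close> takes a single value.\<close>
  proof (rule is_test_fun_antiderivative[OF deriv, of "a - \<bar>h\<bar>" "b + \<bar>h\<bar>"])
    show "\<theta> x = 0" if "x \<notin> {a - \<bar>h\<bar>..b + \<bar>h\<bar>}" for x
    proof (cases "x < a - \<bar>h\<bar>")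
      case True
      then have "x < a" "x + h < a"
        by linarith+
      then show ?thesis
        using c by (simp add: \<theta>_def)
    next
      case False
      then have "b + \<bar>h\<bar> < x"
        using that by simp
      then have "b < x" "b < x + h"
        by linarith+
      then show ?thesis
        using d by (simp add: \<theta>_def)
    qed
    show "is_test_fun (test_app (test_shift h \<psi> - \<psi>))"
      using test_app[of "test_shift h \<psi> - \<psi>"] by (rule CollectD)
  qed
  moreover have "deriv \<theta> = test_app (test_shift h \<psi> - \<psi>)"
    using DERIV_imp_deriv[OF deriv] by (rule ext)
  ultimately have "test_app (test_deriv (Abs_test_fun \<theta>)) = test_app (test_shift h \<psi> - \<psi>)"
    by (simp add: test_deriv.rep_eq Abs_test_fun_inverse)
  then have "test_deriv (Abs_test_fun \<theta>) = test_shift h \<psi> - \<psi>"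
    by (simp only: test_app_inject)
  then show ?thesis ..
qed

lemma integrable_test_app: "integrable lborel (test_app \<phi>)"
proof -
  obtain a b where ab: "\<And>x. x \<notin> {a..b} \<Longrightarrow> test_app \<phi> x = 0"
    using is_test_fun_support[OF test_app[of \<phi>, THEN CollectD]] by blast
  have "integrable lborel (\<lambda>x. indicator {a..b} x *\<^sub>R test_app \<phi> x)"
    by (intro borel_integrable_compact test_fun_continuous) auto
  also have "(\<lambda>x. indicator {a..b} x *\<^sub>R test_app \<phi> x) = test_app \<phi>"
    using ab by (force simp: indicator_def)
  finally show ?thesis .
qed

text \<open>The function is the pointwise limit of step functions that sample it at grid points
  approaching from the left.\<close>

lemma left_continuous_borel_measurable:
  fixes f :: "real \<Rightarrow> real"
  assumes "\<And>x. (f \<longlongrightarrow> f x) (at_left x)"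
  shows "f \<in> borel_measurable borel"
proof (rule borel_measurable_LIMSEQ_real)
  \<comment> \<open>The largest multiple of \<open>1 / real (Suc n)\<close> strictly below
    \<open>x\<close>; ceiling minus one keeps it strict even when \<open>x\<close> is a grid
    point.\<close>
  define u where "u n x = (real_of_int \<lceil>real (Suc n) * x\<rceil> - 1) / real (Suc n)" for n x
  have u: "u n x < x" "x - inverse (real (Suc n)) \<le> u n x" for n x
  proof -
    let ?y = "real (Suc n) * x"
    have "u n x < ?y / real (Suc n)" "(?y - 1) / real (Suc n) \<le> u n x"
      unfolding u_def by (intro divide_strict_right_mono divide_right_mono; linarith)+
    moreover have "?y / real (Suc n) = x" "(?y - 1) / real (Suc n) = x - inverse (real (Suc n))"
      by (simp_all add: field_simps)
    ultimately show "u n x < x" "x - inverse (real (Suc n)) \<le> u n x"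
      by (simp_all only:)
  qed
  have "(\<lambda>n. u n x) \<longlonglongrightarrow> x" for x
  proof (rule tendsto_sandwich[OF _ _ _ tendsto_const])
    show "(\<lambda>n. x - inverse (real (Suc n))) \<longlonglongrightarrow> x"
      using tendsto_diff[OF tendsto_const LIMSEQ_inverse_real_of_nat] by simp
  qed (use u in \<open>auto intro!: always_eventually simp: less_imp_le\<close>)
  then have "filterlim (\<lambda>n. u n x) (at_left x) sequentially" for x
    using u(1) by (auto simp: filterlim_at less_imp_neq intro!: always_eventually)
  then show "(\<lambda>n. f (u n x)) \<longlonglongrightarrow> f x" for x
    by (rule filterlim_compose[OF assms])
  \<comment> \<open>The sampled function factors through the integers, on which every function is
    measurable.\<close>
  have "(\<lambda>x. (\<lambda>i. f ((real_of_int i - 1) / real (Suc n))) \<lceil>real (Suc n) * x\<rceil>)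
      \<in> borel_measurable borel" for n
    by (rule measurable_compose[where N = "count_space UNIV"]) measurable
  then show "(\<lambda>x. f (u n x)) \<in> borel_measurable borel" for n
    by (simp add: u_def)
qed

section \<open>Distributions of regulated functions\<close>

lemma regulated_primitive_measurable:
  assumes "F \<in> regulated_primitives"
  shows "(\<lambda>x. F (ereal x)) \<in> borel_measurable lborel"
  using left_continuous_borel_measurable[of "\<lambda>x. F (ereal x)"] assms
  by (simp add: regulated_primitives_def)

lemma integrable_regulated_primitive:
  assumes "F \<in> regulated_primitives"
  shows "integrable lborel (\<lambda>x. F (ereal x) * test_app \<phi> x)"
proof (rule Bochner_Integration.integrable_bound)
  show "integrable lborel (\<lambda>x. sup_norm F * test_app \<phi> x)"
    by (simp add: integrable_test_app)
  show "(\<lambda>x. F (ereal x) * test_app \<phi> x) \<in> borel_measurable lborel"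
    using regulated_primitive_measurable[OF assms] integrable_test_app[of \<phi>]
    by (intro borel_measurable_times) auto
  have "norm (F (ereal x) * test_app \<phi> x) \<le> norm (sup_norm F * test_app \<phi> x)" for x
  proof -
    have "\<bar>F (ereal x)\<bar> \<le> \<bar>sup_norm F\<bar>"
      using abs_le_sup_norm[OF assms, of "ereal x"] by linarith
    then show ?thesis
      by (simp only: real_norm_def abs_mult mult_right_mono abs_ge_zero)
  qed
  then show "AE x in lborel. norm (F (ereal x) * test_app \<phi> x) \<le> norm (sup_norm F * test_app \<phi> x)"
    by simp
qed

lemma dist_of_fun_add:
  assumes "F \<in> regulated_primitives" "G \<in> regulated_primitives"
  shows "dist_of_fun (F + G) = dist_of_fun F + dist_of_fun G"
  using integrable_regulated_primitive[OF assms(1)] integrable_regulated_primitive[OF assms(2)]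
  by (simp add: dist_of_fun_def fun_eq_iff distrib_right)

lemma dist_of_fun_scaleR: "dist_of_fun (c *\<^sub>R F) = c *\<^sub>R dist_of_fun F"
  by (simp add: dist_of_fun_def fun_eq_iff mult.assoc)

lemma linear_dist_of_fun:
  assumes "F \<in> regulated_primitives"
  shows "linear (dist_of_fun F)"
proof (rule linearI)
  show "dist_of_fun F (\<phi> + \<psi>) = dist_of_fun F \<phi> + dist_of_fun F \<psi>" for \<phi> \<psi>
    using integrable_regulated_primitive[OF assms, of \<phi>] integrable_regulated_primitive[OF assms, of \<psi>]
    by (simp add: dist_of_fun_def plus_test_fun.rep_eq distrib_left)
  show "dist_of_fun F (c *\<^sub>R \<phi>) = c *\<^sub>R dist_of_fun F \<phi>" for c \<phi>
    by (simp add: dist_of_fun_def scaleR_test_fun.rep_eq mult.left_commute[of _ c])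
qed

lemma is_distribution_dist_of_fun:
  assumes F: "F \<in> regulated_primitives"
  shows "is_distribution (dist_of_fun F)"
  unfolding is_distribution_def
proof (intro conjI allI impI linear_dist_of_fun F)
  fix \<Phi> \<phi> assume conv: "test_converges \<Phi> \<phi>"
  then obtain K where K: "compact K" "\<And>j. {x. test_app (\<Phi> j) x \<noteq> 0} \<subseteq> K"
    by (auto simp: test_converges_def)
  have "uniform_limit UNIV (\<lambda>j. (deriv ^^ 0) (test_app (\<Phi> j))) ((deriv ^^ 0) (test_app \<phi>)) sequentially"
    using conv unfolding test_converges_def by blast
  then have unif: "uniform_limit UNIV (\<lambda>j. test_app (\<Phi> j)) (test_app \<phi>) sequentially"
    by simp
  have pt: "(\<lambda>j. test_app (\<Phi> j) x) \<longlonglongrightarrow> test_app \<phi> x" for x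
    using unif by (rule tendsto_uniform_limitI) simp
  have "\<forall>\<^sub>F j in sequentially. \<forall>x\<in>UNIV. dist (test_app (\<Phi> j) x) (test_app \<phi> x) < 1"
    using unif by (rule uniform_limitD) simp
  then obtain N where N: "\<And>j x. j \<ge> N \<Longrightarrow> \<bar>test_app (\<Phi> j) x - test_app \<phi> x\<bar> < 1"
    by (auto simp: eventually_sequentially dist_real_def)
  \<comment> \<open>A dominating function from index \<open>N\<close> on: on \<open>K\<close> the
    test functions are within 1 of \<open>\<phi>\<close>, and off \<open>K\<close> they
    vanish.\<close>
  let ?w = "\<lambda>x. sup_norm F * (\<bar>test_app \<phi> x\<bar> + indicator K x)"
  have "(\<lambda>j. dist_of_fun F (\<Phi> (j + N))) \<longlonglongrightarrow> dist_of_fun F \<phi>"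
    unfolding dist_of_fun_def
  proof (rule integral_dominated_convergence)
    have "integrable lborel (indicator K :: real \<Rightarrow> real)"
      using emeasure_compact_finite[OF K(1)] borel_compact[OF K(1)]
      by (intro integrable_real_indicator) simp_all
    then show "integrable lborel ?w"
      using integrable_test_app[of \<phi>] by simp
    show "AE x in lborel. (\<lambda>j. F (ereal x) * test_app (\<Phi> (j + N)) x) \<longlonglongrightarrow> F (ereal x) * test_app \<phi> x"
      by (intro AE_I2 tendsto_mult_left LIMSEQ_ignore_initial_segment pt)
    have "\<bar>test_app (\<Phi> (j + N)) x\<bar> \<le> \<bar>test_app \<phi> x\<bar> + indicator K x" for j x
    proof (cases "x \<in> K")
      case False
      then have "test_app (\<Phi> (j + N)) x = 0"
        using K(2)[of "j + N"] by blast
      then show ?thesis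
        by simp
    qed (use N[of "j + N" x] in simp)
    then have "norm (F (ereal x) * test_app (\<Phi> (j + N)) x) \<le> ?w x" for j x
      unfolding real_norm_def abs_mult by (rule mult_mono[OF abs_le_sup_norm[OF F]])
        (use abs_le_sup_norm[OF F, of 0] in auto)
    then show "AE x in lborel. norm (F (ereal x) * test_app (\<Phi> (j + N)) x) \<le> ?w x" for j
      by simp
  qed (use integrable_regulated_primitive[OF F] in auto)
  then show "(\<lambda>j. dist_of_fun F (\<Phi> j)) \<longlonglongrightarrow> dist_of_fun F \<phi>"
    by (rule LIMSEQ_offset)
qed

section \<open>Distributional derivatives\<close>

lemma test_deriv_add: "test_deriv (\<phi> + \<psi>) = test_deriv \<phi> + test_deriv \<psi>"
proof (transfer, rule ext)
  fix \<phi> \<psi> :: "real \<Rightarrow> real" and x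
  assume "is_test_fun \<phi>" "is_test_fun \<psi>"
  then show "deriv (\<lambda>x. \<phi> x + \<psi> x) x = deriv \<phi> x + deriv \<psi> x"
    by (intro DERIV_imp_deriv DERIV_add is_test_fun_has_derivative)
qed

lemma test_deriv_scaleR: "test_deriv (c *\<^sub>R \<phi>) = c *\<^sub>R test_deriv \<phi>"
proof (transfer fixing: c, rule ext)
  fix \<phi> :: "real \<Rightarrow> real" and x
  assume "is_test_fun \<phi>"
  then show "deriv (\<lambda>x. c * \<phi> x) x = c * deriv \<phi> x"
    by (intro DERIV_imp_deriv DERIV_cmult is_test_fun_has_derivative)
qed

lemma linear_dist_deriv:
  assumes "linear f"
  shows "linear (dist_deriv f)"
  by (rule linearI)
    (simp_all add: dist_deriv_def test_deriv_add test_deriv_scaleR linear_add[OF assms] linear_scale[OF assms])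

text \<open>The common compact set is kept because its complement is open, so the derivatives vanish
  there too; uniform convergence is the hypothesis at order \<open>Suc k\<close>.\<close>

lemma test_converges_deriv:
  assumes "test_converges \<Phi> \<phi>"
  shows "test_converges (\<lambda>j. test_deriv (\<Phi> j)) (test_deriv \<phi>)"
proof -
  obtain K where K: "compact K" "\<And>j. {x. test_app (\<Phi> j) x \<noteq> 0} \<subseteq> K"
    using assms by (auto simp: test_converges_def)
  have "deriv (test_app (\<Phi> j)) x = 0" if "x \<notin> K" for j x
  proof -
    have "\<forall>\<^sub>F y in nhds x. y \<in> - K"
      using that K(1) by (intro eventually_nhds_in_open) (auto simp: compact_imp_closed open_closed)
    then have "\<forall>\<^sub>F y in nhds x. test_app (\<Phi> j) y = 0"
      by eventually_elim (use K(2)[of j] in auto)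
    then have "deriv (test_app (\<Phi> j)) x = deriv (\<lambda>_. 0) x"
      by (intro deriv_cong_ev refl)
    then show ?thesis
      by simp
  qed
  then have "{x. test_app (test_deriv (\<Phi> j)) x \<noteq> 0} \<subseteq> K" for j
    by (auto simp: test_deriv.rep_eq)
  moreover have "uniform_limit UNIV (\<lambda>j. (deriv ^^ k) (test_app (test_deriv (\<Phi> j))))
      ((deriv ^^ k) (test_app (test_deriv \<phi>))) sequentially" for k
  proof -
    have "(deriv ^^ k) (test_app (test_deriv \<psi>)) = (deriv ^^ Suc k) (test_app \<psi>)" for \<psi>
      by (simp only: funpow_Suc_right o_apply test_deriv.rep_eq)
    then show ?thesis
      using assms by (simp only: test_converges_def)
  qed
  ultimately show ?thesis
    using K(1) unfolding test_converges_def by blast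
qed

lemma is_distribution_dist_deriv:
  assumes "is_distribution f"
  shows "is_distribution (dist_deriv f)"
  unfolding is_distribution_def
proof (intro conjI allI impI)
  show "linear (dist_deriv f)"
    using assms by (simp add: is_distribution_def linear_dist_deriv)
  show "(\<lambda>j. dist_deriv f (\<Phi> j)) \<longlonglongrightarrow> dist_deriv f \<phi>" if "test_converges \<Phi> \<phi>" for \<Phi> \<phi>
    using test_converges_deriv[OF that] assms
    unfolding dist_deriv_def is_distribution_def by (intro tendsto_minus) simp
qed

lemma is_distribution_higher_dist_deriv:
  "is_distribution f \<Longrightarrow> is_distribution ((dist_deriv ^^ n) f)"
  by (induction n) (auto intro: is_distribution_dist_deriv)

lemma higher_dist_deriv_add: "(dist_deriv ^^ n) (f + g) = (dist_deriv ^^ n) f + (dist_deriv ^^ n) g"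
  by (induction n) (auto simp: dist_deriv_def fun_eq_iff)

lemma higher_dist_deriv_scaleR: "(dist_deriv ^^ n) (c *\<^sub>R f) = c *\<^sub>R (dist_deriv ^^ n) f"
  by (induction n) (auto simp: dist_deriv_def fun_eq_iff)

section \<open>Uniqueness of the primitive\<close>

text \<open>The counterpart for distributions of the normalisation at minus infinity: as
  \<open>h\<close> grows, the support of \<open>test_shift h \<psi>\<close> moves to the left. It
  rules out nonzero constants.\<close>

definition vanishes_at_minus_infinity :: "(test_fun \<Rightarrow> real) \<Rightarrow> bool" where
  "vanishes_at_minus_infinity f \<longleftrightarrow> (\<forall>\<psi>. ((\<lambda>h. f (test_shift h \<psi>)) \<longlongrightarrow> 0) at_top)"

text \<open>Differentiation commutes with translation, so up to sign this is the hypothesis for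
  \<open>test_deriv \<psi>\<close>.\<close>

lemma vanishes_at_minus_infinity_dist_deriv:
  assumes "vanishes_at_minus_infinity f"
  shows "vanishes_at_minus_infinity (dist_deriv f)"
  unfolding vanishes_at_minus_infinity_def
proof
  fix \<psi>
  have "((\<lambda>h. - f (test_shift h (test_deriv \<psi>))) \<longlongrightarrow> - 0) at_top"
    using assms unfolding vanishes_at_minus_infinity_def by (intro tendsto_minus) (rule spec)
  then show "((\<lambda>h. dist_deriv f (test_shift h \<psi>)) \<longlongrightarrow> 0) at_top"
    by (simp add: dist_deriv_def test_deriv_shift)
qed

lemma vanishes_at_minus_infinity_dist_of_fun:
  assumes F: "F \<in> regulated_primitives"
  shows "vanishes_at_minus_infinity (dist_of_fun F)"
  unfolding vanishes_at_minus_infinity_def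
proof
  fix \<psi>
  \<comment> \<open>Substitution moves the translation onto \<open>F\<close>, so that dominated
    convergence applies with a fixed \<open>\<psi>\<close>.\<close>
  have eq: "dist_of_fun F (test_shift h \<psi>) = (LINT y|lborel. F (ereal (y - h)) * test_app \<psi> y)" for h
    using lborel_integral_real_affine[of 1 "\<lambda>x. F (ereal x) * test_app \<psi> (x + h)" "- h"]
    by (simp add: dist_of_fun_def test_shift.rep_eq)
  have "((\<lambda>h. LINT y|lborel. F (ereal (y - h)) * test_app \<psi> y) \<longlongrightarrow> (LINT y::real|lborel. 0)) at_top"
  proof (rule integral_dominated_convergence_at_top)
    have meas: "(\<lambda>y. F (ereal (y - h))) \<in> borel_measurable borel" for h
      by (rule measurable_compose[of "\<lambda>y. y - h" borel borel "\<lambda>x. F (ereal x)"])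
        (use regulated_primitive_measurable[OF F] in simp_all)
    show "(\<lambda>y. F (ereal (y - h)) * test_app \<psi> y) \<in> borel_measurable lborel" for h
      using meas integrable_test_app[of \<psi>] by (intro borel_measurable_times) auto
    show "integrable lborel (\<lambda>y. sup_norm F * \<bar>test_app \<psi> y\<bar>)"
      using integrable_test_app[of \<psi>] by simp
    have "((\<lambda>h. F (ereal (y - h)) * test_app \<psi> y) \<longlongrightarrow> 0) at_top" for y
    proof -
      have "filterlim (\<lambda>h. y - h) at_bot at_top"
        unfolding filterlim_at_bot eventually_at_top_linorder
      proof
        show "\<exists>N. \<forall>h\<ge>N. y - h \<le> Z" for Z
          by (intro exI[of _ "y - Z"]) auto
      qed
      moreover have "((\<lambda>t. F (ereal t)) \<longlongrightarrow> F (-\<infinity>)) at_bot" "F (-\<infinity>) = 0"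
        using F unfolding regulated_primitives_def regulated_def by blast+
      then have "((\<lambda>t. F (ereal t)) \<longlongrightarrow> 0) at_bot"
        by simp
      ultimately have "((\<lambda>h. F (ereal (y - h))) \<longlongrightarrow> 0) at_top"
        by (rule filterlim_compose[rotated])
      then show ?thesis
        by (rule tendsto_mult_left_zero)
    qed
    then show "AE y in lborel. ((\<lambda>h. F (ereal (y - h)) * test_app \<psi> y) \<longlongrightarrow> 0) at_top"
      by simp
    have "norm (F (ereal (y - h)) * test_app \<psi> y) \<le> sup_norm F * \<bar>test_app \<psi> y\<bar>" for h y
      unfolding real_norm_def abs_mult by (intro mult_right_mono abs_le_sup_norm F) simp
    then show "\<forall>\<^sub>F h in at_top. AE y in lborel.
        norm (F (ereal (y - h)) * test_app \<psi> y) \<le> sup_norm F * \<bar>test_app \<psi> y\<bar>"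
      by simp
  qed simp
  then show "((\<lambda>h. dist_of_fun F (test_shift h \<psi>)) \<longlongrightarrow> 0) at_top"
    by (simp add: eq)
qed

lemma dist_deriv_eq_0D:
  assumes "linear f" "vanishes_at_minus_infinity f" "dist_deriv f = 0"
  shows "f = 0"
proof
  fix \<psi>
  have "f (test_shift h \<psi>) = f \<psi>" for h
  proof -
    obtain \<theta> where "test_deriv \<theta> = test_shift h \<psi> - \<psi>"
      using ex_test_deriv_eq_shift_diff by blast
    moreover have "dist_deriv f \<theta> = 0"
      by (simp add: assms(3))
    ultimately show ?thesis
      using linear_diff[OF assms(1)] by (simp add: dist_deriv_def)
  qed
  moreover have "((\<lambda>h. f (test_shift h \<psi>)) \<longlongrightarrow> 0) at_top"
    using assms(2) by (simp add: vanishes_at_minus_infinity_def)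
  ultimately have "((\<lambda>h::real. f \<psi>) \<longlongrightarrow> 0) at_top"
    by (simp only:)
  then show "f \<psi> = 0 \<psi>"
    by (simp add: tendsto_const_iff)
qed

text \<open>The outermost derivative is removed at each step, as all intermediate derivatives stay
  linear and vanish at minus infinity.\<close>

lemma higher_dist_deriv_eq_0D:
  assumes "linear f" "vanishes_at_minus_infinity f" "(dist_deriv ^^ n) f = 0"
  shows "f = 0"
  using assms(3)
proof (induction n)
  case (Suc n)
  have "linear ((dist_deriv ^^ n) f) \<and> vanishes_at_minus_infinity ((dist_deriv ^^ n) f)"
    using assms(1,2)
    by (induction n) (simp_all add: linear_dist_deriv vanishes_at_minus_infinity_dist_deriv)
  moreover have "dist_deriv ((dist_deriv ^^ n) f) = 0"
    using Suc.prems by (simp only: funpow.simps o_apply)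
  ultimately have "(dist_deriv ^^ n) f = 0"
    using dist_deriv_eq_0D[of "(dist_deriv ^^ n) f"] by simp
  then show ?case
    by (rule Suc.IH)
qed simp

text \<open>A positive value persists on an interval to the left of \<open>x\<close> by left
  continuity, and a bump supported there would have a positive pairing with
  \<open>F\<close>.\<close>

lemma dist_of_fun_eq_0_le:
  assumes F: "F \<in> regulated_primitives" and "dist_of_fun F = 0"
  shows "F (ereal x) \<le> 0"
proof (rule ccontr)
  assume "\<not> F (ereal x) \<le> 0"
  then have "0 < F (ereal x)"
    by simp
  moreover have "((\<lambda>t. F (ereal t)) \<longlongrightarrow> F (ereal x)) (at_left x)"
    using F by (simp add: regulated_primitives_def)
  ultimately have "\<forall>\<^sub>F t in at_left x. 0 < F (ereal t)"
    by (intro order_tendstoD(1))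
  then obtain a where a: "a < x" "\<And>t. a < t \<Longrightarrow> t < x \<Longrightarrow> 0 < F (ereal t)"
    unfolding eventually_at_left_field by blast
  define \<phi> where "\<phi> = Abs_test_fun (bump a x)"
  have \<phi>: "test_app \<phi> = bump a x"
    by (simp add: \<phi>_def Abs_test_fun_inverse is_test_fun_bump)
  have nonneg: "0 \<le> F (ereal t) * bump a x t" for t
    using a(2)[of t] bump_nonneg[of a x t] bump_eq_0[of t a x] by (cases "t \<in> {a<..<x}") auto
  have "dist_of_fun F \<phi> = 0"
    by (simp add: assms(2))
  then have "(LINT t|lborel. F (ereal t) * bump a x t) = 0"
    by (simp add: dist_of_fun_def \<phi>)
  then have "AE t in lborel. F (ereal t) * bump a x t = 0"
    using integrable_regulated_primitive[OF F, of \<phi>] nonneg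
    by (subst (asm) integral_nonneg_eq_0_iff_AE) (simp_all add: \<phi>)
  moreover have "F (ereal t) * bump a x t \<noteq> 0" if "t \<in> {a<..<x}" for t
    using that a(2)[of t] bump_pos_iff[of a x t] by auto
  ultimately have "AE t in lborel. t \<notin> {a<..<x}"
    by (auto elim!: eventually_mono)
  then have "emeasure lborel {a<..<x} = 0"
    by (subst (asm) AE_iff_measurable[of "{a<..<x}"]) auto
  then show False
    using a(1) by simp
qed

lemma dist_of_fun_eq_0D:
  assumes F: "F \<in> regulated_primitives" and "dist_of_fun F = 0"
  shows "F = 0"
proof
  fix y
  \<comment> \<open>The one-sided bound is applied to \<open>F\<close> and to its negative.\<close>
  have "- 1 *\<^sub>R F \<in> regulated_primitives"
    using F by (intro subspace_scale regulated_primitives_subspace)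
  moreover have "dist_of_fun (- 1 *\<^sub>R F) = 0"
    unfolding dist_of_fun_scaleR assms(2) by simp
  ultimately have "(- 1 *\<^sub>R F) (ereal x) \<le> 0" for x
    by (rule dist_of_fun_eq_0_le)
  then have "F (ereal x) = 0" for x
    using dist_of_fun_eq_0_le[OF assms, of x] by (simp add: antisym)
  then have "\<bar>F (ereal x)\<bar> \<le> 0" for x
    by simp
  then have "\<bar>F y\<bar> \<le> 0"
    using F regulated_abs_le[of F 0 y] by (simp add: regulated_primitives_def)
  then show "F y = 0 y"
    by simp
qed

lemma inj_on_higher_dist_deriv:
  "inj_on (\<lambda>F. (dist_deriv ^^ n) (dist_of_fun F)) regulated_primitives"
proof (rule inj_onI)
  fix F G assume F: "F \<in> regulated_primitives" and G: "G \<in> regulated_primitives"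
    and eq: "(dist_deriv ^^ n) (dist_of_fun F) = (dist_deriv ^^ n) (dist_of_fun G)"
  have G': "- 1 *\<^sub>R G \<in> regulated_primitives"
    using G by (intro subspace_scale regulated_primitives_subspace)
  have D: "F + - 1 *\<^sub>R G \<in> regulated_primitives"
    using F G' by (intro subspace_add regulated_primitives_subspace)
  have "(dist_deriv ^^ n) (dist_of_fun (F + - 1 *\<^sub>R G)) = 0"
    unfolding dist_of_fun_add[OF F G'] dist_of_fun_scaleR higher_dist_deriv_add
      higher_dist_deriv_scaleR eq by simp
  then have "dist_of_fun (F + - 1 *\<^sub>R G) = 0"
    by (rule higher_dist_deriv_eq_0D[OF linear_dist_of_fun[OF D]
          vanishes_at_minus_infinity_dist_of_fun[OF D]])
  then have "F + - 1 *\<^sub>R G = 0"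
    by (rule dist_of_fun_eq_0D[OF D])
  then show "F = G"
    by simp
qed

section \<open>The spaces of primitives and of their derivatives\<close>

text \<open>Injectivity on all regulated primitives makes the definite description well defined for
  either choice of \<open>C\<close>.\<close>

lemma dist_primitive_eq:
  assumes "C \<subseteq> regulated_primitives" "F \<in> C"
  shows "dist_primitive C n ((dist_deriv ^^ n) (dist_of_fun F)) = F"
  unfolding dist_primitive_def
proof (rule the_equality)
  fix G assume "G \<in> C \<and> (dist_deriv ^^ n) (dist_of_fun F) = (dist_deriv ^^ n) (dist_of_fun G)"
  then show "G = F"
    using assms by (intro inj_onD[OF inj_on_higher_dist_deriv[of n]]) auto
qed (use assms in simp)

context primitives_lattice
begin

interpretation M: abstract_M_space L
  by (rule abstract_M_space)

interpretation T: isometric_transport L "\<lambda>F. (dist_deriv ^^ n) (dist_of_fun F)" "dist_primitive C n" for n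
proof
  fix F G assume "F \<in> carrier L" "G \<in> carrier L"
  then show "(dist_deriv ^^ n) (dist_of_fun (F + G))
      = (dist_deriv ^^ n) (dist_of_fun F) + (dist_deriv ^^ n) (dist_of_fun G)"
    using subset dist_of_fun_add[of F G] by (simp add: subset_iff higher_dist_deriv_add)
qed (auto simp: dist_of_fun_scaleR higher_dist_deriv_scaleR dist_primitive_eq[OF subset])

text \<open>Every derivative of \<open>dist_of_fun F\<close> is a distribution, so the carriers
  agree; order and norm agree by definition.\<close>

lemma deriv_space_eq_transported:
  "deriv_space L n = transported_space L (\<lambda>F. (dist_deriv ^^ n) (dist_of_fun F)) (dist_primitive C n)"
proof -
  have "is_distribution ((dist_deriv ^^ n) (dist_of_fun F))" if "F \<in> C" for F
    using that subset by (intro is_distribution_higher_dist_deriv is_distribution_dist_of_fun) auto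
  then show ?thesis
    by (auto simp: deriv_space_def transported_space_def)
qed

lemma abstract_M_space_deriv_space: "abstract_M_space (deriv_space L n)"
  unfolding deriv_space_eq_transported
  by (rule T.abstract_M_space_transported[OF abstract_M_space])

lemma abstract_L_space_deriv_spaceD: "abstract_L_space (deriv_space L n) \<Longrightarrow> abstract_L_space L"
  unfolding deriv_space_eq_transported by (rule T.abstract_L_space_transportedD)

end

section \<open>Ramps and the failure of additivity of the norm\<close>

definition ramp :: "real \<Rightarrow> real \<Rightarrow> ereal \<Rightarrow> real" where
  "ramp a b x = real_of_ereal (max (ereal a) (min (ereal b) x)) - a"

lemma ramp_ereal: "ramp a b (ereal x) = max a (min b x) - a"
  by (auto simp: ramp_def max_def min_def)

text \<open>The argument is clamped before it is converted to a real, so the conversion is applied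
  only to finite values, where it is continuous.\<close>

lemma ramp_mem_continuous_primitives: "a \<le> b \<Longrightarrow> ramp a b \<in> continuous_primitives"
proof -
  assume "a \<le> b"
  have "max (ereal a) (min (ereal b) x) \<in> UNIV - {\<infinity>, - \<infinity>}" for x
    by (cases x) (auto simp: max_def min_def)
  then have "range (\<lambda>x. max (ereal a) (min (ereal b) x)) \<subseteq> UNIV - {\<infinity>, - \<infinity>}"
    by (rule image_subsetI)
  moreover have "continuous_on UNIV (\<lambda>x. max (ereal a) (min (ereal b) x))"
    by (intro continuous_on_max continuous_on_min continuous_intros)
  ultimately have "continuous_on UNIV (\<lambda>x. real_of_ereal (max (ereal a) (min (ereal b) x)))"
    by (intro continuous_on_compose2[OF continuous_on_real])
  then have "continuous_on UNIV (ramp a b)"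
    unfolding ramp_def[abs_def] by (intro continuous_intros)
  moreover have "ramp a b (-\<infinity>) = 0"
    by (simp add: ramp_def)
  ultimately show ?thesis
    by (simp add: continuous_primitives_def)
qed

text \<open>The tent \<open>ramp 0 1 - ramp 1 2\<close> and \<open>ramp 1 2\<close> add up to \<open>ramp 0 1\<close>; all three have norm 1.\<close>

lemma (in primitives_lattice) not_abstract_L_space:
  assumes "continuous_primitives \<subseteq> C"
  shows "\<not> abstract_L_space L"
proof
  assume "abstract_L_space L"
  then interpret A: abstract_L_space L .
  let ?U = "ramp 0 1 - ramp 1 2" and ?V = "ramp 1 2"
  have mem: "ramp 0 1 \<in> C" "?V \<in> C"
    using assms ramp_mem_continuous_primitives[of 0 1] ramp_mem_continuous_primitives[of 1 2] by auto
  then have U: "?U \<in> C"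
    by simp
  have norm: "sup_norm F = 1"
    if "F \<in> C" "\<And>x::real. \<bar>F (ereal x)\<bar> \<le> 1" "\<bar>F (ereal y)\<bar> = 1" for F y
    using that subset by (intro sup_norm_eqI) auto
  \<comment> \<open>The value 1 is attained at 1 by the first ramp and at 2 by the second; the tent
    below peaks at 1.\<close>
  have "sup_norm (ramp 0 1) = 1" "sup_norm ?V = 1"
    by (rule norm[where y = 1] norm[where y = 2]; use mem in \<open>simp add: ramp_ereal\<close>)+
  moreover have "sup_norm ?U = 1"
    by (rule norm[of ?U 1]) (use U in \<open>auto simp: ramp_ereal\<close>)
  moreover have "sup_norm (?U + ?V) = sup_norm ?U + sup_norm ?V"
  proof -
    have "?U \<in> carrier L" "?V \<in> carrier L"
      using U mem by simp_all
    moreover have "0 \<sqsubseteq>\<^bsub>L\<^esub> ?U" "0 \<sqsubseteq>\<^bsub>L\<^esub> ?V"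
      by (auto simp: ramp_ereal max_def min_def)
    ultimately have "nrm L (?U + ?V) = nrm L ?U + nrm L ?V"
      by (rule A.nrm_add)
    then show ?thesis
      by (simp only: sup_norm_space_sel)
  qed
  ultimately show False
    by simp
qed

section \<open>The regulated and the continuous instance\<close>

interpretation regulated: primitives_lattice regulated_primitives
  by unfold_locales
    (auto intro: regulated_primitives_subspace regulated_primitives_max regulated_primitives_uniform_limit)

interpretation continuous: primitives_lattice continuous_primitives
  by unfold_locales
    (auto intro: continuous_primitives_subspace continuous_primitives_max
      continuous_primitives_uniform_limit continuous_primitives_subset[THEN subsetD])

theorem theorem23:
  fixes n :: nat
  shows "(abstract_M_space B_r \<and> abstract_M_space B_c \<and>
          abstract_M_space (A_r n) \<and> abstract_M_space (A_c n)) \<and>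
         (\<not> abstract_L_space B_r \<and> \<not> abstract_L_space B_c \<and>
          \<not> abstract_L_space (A_r n) \<and> \<not> abstract_L_space (A_c n))"
  unfolding A_r_def A_c_def B_r_def B_c_def
  using regulated.abstract_M_space continuous.abstract_M_space
    regulated.abstract_M_space_deriv_space[of n] continuous.abstract_M_space_deriv_space[of n]
    regulated.not_abstract_L_space[OF continuous_primitives_subset]
    continuous.not_abstract_L_space[OF order_refl]
    regulated.abstract_L_space_deriv_spaceD[of n] continuous.abstract_L_space_deriv_spaceD[of n]
  by blast

end
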